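(* Let $K$ be a field of prime characteristic $p>0$, let $F\in K[X,Y,Z,W]$ be homogeneous of degree four, let $R=K[X,Y,Z,W]/(F)$ be the homogeneous coordinate ring of a K3 surface in $\mathbb P^3_K$ (a smooth quartic surface), and let $a,b\in R$ be homogeneous elements such that $e_{gHK}(R/(a,b))\notin\mathbb Q$. Put $I=(a,b)$. Then $R/I$ satisfies the (LC) condition: there is $c\in\mathbb N_0$, not depending on $q$, such that $\mathfrak m^{cq}H^0_{\mathfrak m}(R/I^{[q]})=0$ for all $q=p^n$, $n\in\mathbb N$, where $\mathfrak m$ is the irrelevant maximal ideal of $R$.
   Context: $\mathbb N=\{1,2,\dots\}$, $\mathbb N_0=\mathbb N\cup\{0\}$. $I^{[q]}=(x^q:x\in I)$. $H^0_{\mathfrak m}(M)$ is the submodule of elements of $M$ annihilated by some power of $\mathfrak m$. $f_{gHK}^{R/I}(n)$ is the length of $H^0_{\mathfrak m}(R/I^{[p^n]})$ and $e_{gHK}(R/I)=\lim_{n\to\infty} f_{gHK}^{R/I}(n)/p^{n\dim R}$ if the limit exists, and $\infty$ otherwise; here $e_{gHK}(R/(a,b))\notin\mathbb Q$ means that it is an irrational real number. *)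

theory Defs
  imports
    "HOL-Algebra.Algebra"
    "HOL-Algebra.Algebraic_Closure_Type"
    "HOL-Library.Poly_Mapping"
    "HOL-Library.Numeral_Type"
    "HOL-Library.Extended_Real"
begin

section \<open>Modules over a commutative ring: length, quotients, local cohomology in degree zero\<close>

definition module_length :: "('a, 'b) ring_scheme \<Rightarrow> ('a, 'c, 'd) module_scheme \<Rightarrow> enat" where
  "module_length R M =
     Sup {enat n | n. \<exists>N :: nat \<Rightarrow> 'c set.
        (\<forall>i\<le>n. submodule (N i) R M) \<and> (\<forall>i<n. N i \<subset> N (Suc i))}"

definition krull_dim :: "('a, 'b) ring_scheme \<Rightarrow> enat" where
  "krull_dim R =
     Sup {enat n | n. \<exists>P :: nat \<Rightarrow> 'a set.
        (\<forall>i\<le>n. primeideal (P i) R) \<and> (\<forall>i<n. P i \<subset> P (Suc i))}"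

text \<open>The quotient \<open>R / J\<close> by an ideal, as an \<open>R\<close>-module.\<close>

definition quot_module :: "('a, 'b) ring_scheme \<Rightarrow> 'a set \<Rightarrow> ('a, 'a set) module" where
  "quot_module R J =
     \<lparr>carrier = carrier (R Quot J), monoid.mult = monoid.mult (R Quot J), one = monoid.one (R Quot J),
      ring.zero = ring.zero (R Quot J), add = add (R Quot J),
      module.smult = (\<lambda>r x. (J +>\<^bsub>R\<^esub> r) \<otimes>\<^bsub>R Quot J\<^esub> x)\<rparr>"

abbreviation ideal_power :: "('a, 'b) ring_scheme \<Rightarrow> 'a set \<Rightarrow> nat \<Rightarrow> 'a set" where
  "ideal_power R I n \<equiv> I [^]\<^bsub>ideals_set R\<^esub> n"

definition local_cohomology0 ::
    "('a, 'b) ring_scheme \<Rightarrow> 'a set \<Rightarrow> ('a, 'c, 'd) module_scheme \<Rightarrow> 'c set" where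
  "local_cohomology0 R m M =
     {x \<in> carrier M. \<exists>k::nat. \<forall>r \<in> ideal_power R m k. r \<odot>\<^bsub>M\<^esub> x = \<zero>\<^bsub>M\<^esub>}"

section \<open>Generalized Hilbert--Kunz multiplicity and the (LC) condition\<close>

definition frobenius_power :: "('a, 'b) ring_scheme \<Rightarrow> 'a set \<Rightarrow> nat \<Rightarrow> 'a set" where
  "frobenius_power R I q = Idl\<^bsub>R\<^esub> {x [^]\<^bsub>R\<^esub> q | x. x \<in> I}"

definition f_gHK :: "('a, 'b) ring_scheme \<Rightarrow> 'a set \<Rightarrow> nat \<Rightarrow> 'a set \<Rightarrow> nat \<Rightarrow> enat" where
  "f_gHK R m p I n =
     (let M = quot_module R (frobenius_power R I (p ^ n))
      in module_length R (M\<lparr>carrier := local_cohomology0 R m M\<rparr>))"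

text \<open>The limit is taken in the extended reals, where the default value \<open>\<infinity>\<close> and divergence to
  \<open>\<infinity>\<close> agree; a finite value is an ordinary real limit. The Krull dimension is converted by
  \<open>the_enat\<close>, so the definition is meaningful for rings of finite dimension only.\<close>

definition e_gHK :: "('a, 'b) ring_scheme \<Rightarrow> 'a set \<Rightarrow> nat \<Rightarrow> 'a set \<Rightarrow> ereal" where
  "e_gHK R m p I =
     (let s = (\<lambda>n. ereal_of_enat (f_gHK R m p I n) / ereal (real p ^ (n * the_enat (krull_dim R))))
      in if convergent s then lim s else \<infinity>)"

definition LC_condition :: "('a, 'b) ring_scheme \<Rightarrow> 'a set \<Rightarrow> nat \<Rightarrow> 'a set \<Rightarrow> bool" where
  "LC_condition R m p I \<longleftrightarrow>
     (\<exists>c::nat. \<forall>n\<ge>1.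
        let q = p ^ n; M = quot_module R (frobenius_power R I q)
        in \<forall>r \<in> ideal_power R m (c * q). \<forall>x \<in> local_cohomology0 R m M. r \<odot>\<^bsub>M\<^esub> x = \<zero>\<^bsub>M\<^esub>)"

section \<open>Hypersurfaces in projective three-space\<close>

text \<open>Polynomials in four variables: finitely supported maps from exponent vectors to
  coefficients, with the convolution product.\<close>

type_synonym 'k poly4 = "(4 \<Rightarrow>\<^sub>0 nat) \<Rightarrow>\<^sub>0 'k"

definition homogeneous :: "nat \<Rightarrow> 'k::zero poly4 \<Rightarrow> bool" where
  "homogeneous d f \<longleftrightarrow> (\<forall>u \<in> Poly_Mapping.keys f. (\<Sum>i\<in>UNIV. Poly_Mapping.lookup u i) = d)"

definition partial_deriv :: "4 \<Rightarrow> 'k::field poly4 \<Rightarrow> 'k poly4" where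
  "partial_deriv i f =
     (\<Sum>u\<in>Poly_Mapping.keys f.
        Poly_Mapping.single (u - Poly_Mapping.single i 1)
          (of_nat (Poly_Mapping.lookup u i) * Poly_Mapping.lookup f u))"

definition eval_ac :: "(4 \<Rightarrow> 'k::field alg_closure) \<Rightarrow> 'k poly4 \<Rightarrow> 'k alg_closure" where
  "eval_ac x f =
     (\<Sum>u\<in>Poly_Mapping.keys f.
        to_ac (Poly_Mapping.lookup f u) * (\<Prod>i\<in>UNIV. x i ^ Poly_Mapping.lookup u i))"

text \<open>Jacobian criterion over the algebraic closure. The equation itself is listed with its
  partial derivatives, because Euler's formula does not recover it when the characteristic
  divides the degree. The zero polynomial is not smooth.\<close>

definition smooth_hypersurface :: "'k::field poly4 \<Rightarrow> bool" where
  "smooth_hypersurface F \<longleftrightarrow>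
     \<not> (\<exists>x :: 4 \<Rightarrow> 'k alg_closure. x \<noteq> (\<lambda>_. 0) \<and> eval_ac x F = 0 \<and>
           (\<forall>i. eval_ac x (partial_deriv i F) = 0))"

abbreviation poly4_ring :: "'k::field poly4 ring" where
  "poly4_ring \<equiv> ring_of_type_algebra"

definition coord_ring :: "'k::field poly4 \<Rightarrow> 'k poly4 set ring" where
  "coord_ring F = poly4_ring Quot (Idl\<^bsub>poly4_ring\<^esub> {F})"

definition residue_class :: "'k::field poly4 \<Rightarrow> 'k poly4 \<Rightarrow> 'k poly4 set" where
  "residue_class F f = (Idl\<^bsub>poly4_ring\<^esub> {F}) +>\<^bsub>poly4_ring\<^esub> f"

definition homogeneous_elements :: "'k::field poly4 \<Rightarrow> nat \<Rightarrow> 'k poly4 set set" where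
  "homogeneous_elements F d = {residue_class F f | f. homogeneous d f}"

definition irrelevant_ideal :: "'k::field poly4 \<Rightarrow> 'k poly4 set set" where
  "irrelevant_ideal F = Idl\<^bsub>coord_ring F\<^esub> (\<Union>d\<in>{1..}. homogeneous_elements F d)"

section \<open>Well-formedness of the constructions\<close>

lemma cring_coord_ring: "cring (coord_ring F)"
proof -
  interpret S: cring "poly4_ring :: 'a poly4 ring" by (rule cring_from_type_algebra)
  have "ideal (Idl\<^bsub>poly4_ring\<^esub> {F}) poly4_ring"
    by (rule S.genideal_ideal) (simp add: ring_of_type_algebra_def)
  then show ?thesis
    unfolding coord_ring_def by (rule ideal.quotient_is_cring) (rule S.is_cring)
qed

lemma ideal_irrelevant_ideal: "ideal (irrelevant_ideal F) (coord_ring F)"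
proof -
  interpret R: cring "coord_ring F" by (rule cring_coord_ring)
  have "(\<Union>d\<in>{1..}. homogeneous_elements F d) \<subseteq> carrier (coord_ring F)"
    by (auto simp: homogeneous_elements_def residue_class_def coord_ring_def FactRing_def
        A_RCOSETS_def RCOSETS_def a_r_coset_def ring_of_type_algebra_def)
  then show ?thesis
    unfolding irrelevant_ideal_def by (rule R.genideal_ideal)
qed

lemma module_quot_module:
  assumes "cring R" "ideal J R"
  shows "module R (quot_module R J)"
proof -
  interpret R: cring R by fact
  interpret J: ideal J R by fact
  interpret Q: cring "R Quot J" by (rule J.quotient_is_cring) fact
  interpret h: ring_hom_ring R "R Quot J" "(+>\<^bsub>R\<^esub>) J"
    by (rule J.rcos_ring_hom_ring)
  have "abelian_group (quot_module R J)"
    by (rule abelian_groupI)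
      (simp_all add: quot_module_def Q.add.m_ac Q.add.l_inv_ex)
  then show ?thesis
    using h.hom_closed
    by (intro moduleI \<open>cring R\<close>)
      (simp_all add: quot_module_def Q.l_distr Q.r_distr Q.m_assoc)
qed

lemma submodule_local_cohomology0:
  assumes "module R M" "ideal m R"
  shows "submodule (local_cohomology0 R m M) R M"
proof -
  interpret module R M by fact
  interpret P: comm_monoid "ideals_set R" by (rule R.ideals_set_is_comm_monoid)
  have pow: "ideal (ideal_power R m k) R" for k :: nat
    using P.nat_pow_closed[of m k] assms(2) by (simp add: ideals_set_def)
  have le: "ideal_power R m (k + l) \<subseteq> ideal_power R m k \<inter> ideal_power R m l" for k l :: nat
  proof -
    have "ideal_power R m (k + l) = ideal_power R m k \<cdot>\<^bsub>R\<^esub> ideal_power R m l"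
      using P.nat_pow_mult[of m k l] assms(2) by (simp add: ideals_set_def)
    then show ?thesis
      using R.ideal_prod_inter[OF pow pow] by simp
  qed
  have carr: "r \<in> carrier R" if "r \<in> ideal_power R m k" for r and k :: nat
    using that ideal.Icarr[OF pow] by blast
  show ?thesis
  proof (rule submoduleI)
    fix x y assume "x \<in> local_cohomology0 R m M" "y \<in> local_cohomology0 R m M"
    then obtain k l :: nat where *: "x \<in> carrier M" "y \<in> carrier M"
      "\<forall>r \<in> ideal_power R m k. r \<odot>\<^bsub>M\<^esub> x = \<zero>\<^bsub>M\<^esub>"
      "\<forall>r \<in> ideal_power R m l. r \<odot>\<^bsub>M\<^esub> y = \<zero>\<^bsub>M\<^esub>"
      unfolding local_cohomology0_def by blast
    then have "\<forall>r \<in> ideal_power R m (k + l). r \<odot>\<^bsub>M\<^esub> (x \<oplus>\<^bsub>M\<^esub> y) = \<zero>\<^bsub>M\<^esub>"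
      using le[of k l] carr by (auto simp: smult_r_distr subset_iff)
    with * show "x \<oplus>\<^bsub>M\<^esub> y \<in> local_cohomology0 R m M"
      unfolding local_cohomology0_def by blast
  next
    fix r x assume "r \<in> carrier R" "x \<in> local_cohomology0 R m M"
    then obtain k :: nat where *: "r \<in> carrier R" "x \<in> carrier M"
      "\<forall>s \<in> ideal_power R m k. s \<odot>\<^bsub>M\<^esub> x = \<zero>\<^bsub>M\<^esub>"
      unfolding local_cohomology0_def by blast
    have "s \<odot>\<^bsub>M\<^esub> (r \<odot>\<^bsub>M\<^esub> x) = \<zero>\<^bsub>M\<^esub>" if "s \<in> ideal_power R m k" for s
      using * that carr[OF that] smult_assoc1[of s r x] ideal.I_r_closed[OF pow that, of r] by simp
    with * show "r \<odot>\<^bsub>M\<^esub> x \<in> local_cohomology0 R m M"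
      unfolding local_cohomology0_def by blast
  qed (use carr in \<open>auto simp: local_cohomology0_def smult_r_minus\<close>)
qed

end

(* The coordinate ring is R = S/(F) with S = K[X_0,...,X_3]. Let J = (F,A,B), where A and B lift a and b,
   and let q = p^n. Since S is free over its subring of q-th powers, H^0_m(S/J^[q]) is killed by the
   q-th powers of any powers of the variables that kill H^0_m(S/J). To pass from J^[q] to (F,A^q,B^q),
   let T_j f be the coefficient of t^(q-1) in f(X_j + t). It is linear over q-th powers, so
   T_j(F^(q-1) * _) maps (F,A^q,B^q) into J^[q], and modulo F it is multiplication by (dF/dX_j)^(q-1).
   Hence H^0_m(R/I^[q]) is killed by the q-th powers of the products of dF/dX_j with fixed powers of the
   variables. Smoothness and the Nullstellensatz put a fixed power of every variable into the ideal of F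
   and its partial derivatives, so a bound linear in q results. *)

theory Submission
  imports Defs
begin

section \<open>Ideals and homomorphisms of type-class rings\<close>

text \<open>The obstacle is that the cone over the surface is singular at its vertex: Frobenius is
  flat on \<open>S\<close> but not on \<open>R\<close>, and the Frobenius power of the lifted ideal
  contains \<open>F ^ q\<close> where \<open>F\<close> is wanted. Multiplication by
  \<open>F ^ (q - 1)\<close> bridges the two ideals but cannot simply be cancelled; a differential
  operator removes it. Its order \<open>q - 1\<close> is forced: a lower order sends multiples of
  \<open>F ^ (q - 1)\<close> into \<open>(F)\<close>, and from order \<open>q\<close> on linearity
  over q-th powers fails. The price is a power of a partial derivative, which smoothness absorbs.
  The constant obtained is \<open>4 * (s + m)\<close>, with \<open>s\<close> from smoothness,
  \<open>m\<close> from noetherianity applied to \<open>(F, A, B)\<close>, and 4 the number of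
  variables. Since \<open>K\<close> is arbitrary, it may have infinite degree over its subfield of
  q-th powers, so expansions over that subfield use finite index sets that depend on the
  element.\<close>

definition is_ideal :: "'a::comm_ring_1 set \<Rightarrow> bool" where
  "is_ideal I \<longleftrightarrow> 0 \<in> I \<and> (\<forall>x\<in>I. \<forall>y\<in>I. x + y \<in> I) \<and> (\<forall>r. \<forall>x\<in>I. r * x \<in> I)"

lemma is_idealI:
  assumes "0 \<in> I" "\<And>x y. x \<in> I \<Longrightarrow> y \<in> I \<Longrightarrow> x + y \<in> I" "\<And>r x. x \<in> I \<Longrightarrow> r * x \<in> I"
  shows "is_ideal I"
  using assms unfolding is_ideal_def by blast

lemma
  assumes "is_ideal I"
  shows is_ideal_0: "0 \<in> I"
    and is_ideal_add: "x \<in> I \<Longrightarrow> y \<in> I \<Longrightarrow> x + y \<in> I"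
    and is_ideal_mult: "x \<in> I \<Longrightarrow> r * x \<in> I"
  using assms unfolding is_ideal_def by blast+

lemma is_ideal_mult': "is_ideal I \<Longrightarrow> x \<in> I \<Longrightarrow> x * r \<in> I"
  using is_ideal_mult[of I x r] by (simp add: mult.commute)

lemma is_ideal_uminus: "is_ideal I \<Longrightarrow> x \<in> I \<Longrightarrow> - x \<in> I"
  using is_ideal_mult[of I x "-1"] by simp

lemma is_ideal_diff: "is_ideal I \<Longrightarrow> x \<in> I \<Longrightarrow> y \<in> I \<Longrightarrow> x - y \<in> I"
  using is_ideal_add[of I x "- y"] is_ideal_uminus[of I y] by simp

lemma is_ideal_sum:
  assumes "is_ideal I" "\<And>i. i \<in> A \<Longrightarrow> f i \<in> I"
  shows "sum f A \<in> I"
  using assms(2)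
  by (induction A rule: infinite_finite_induct) (auto intro: assms(1) is_ideal_0 is_ideal_add)

definition is_prime_ideal :: "'a::comm_ring_1 set \<Rightarrow> bool" where
  "is_prime_ideal P \<longleftrightarrow> is_ideal P \<and> 1 \<notin> P \<and> (\<forall>x y. x * y \<in> P \<longrightarrow> x \<in> P \<or> y \<in> P)"

text \<open>Zorn: let \<open>P\<close> be maximal among the ideals over \<open>I\<close> that
  contain no power of \<open>\<beta>\<close>. For \<open>x\<close> outside \<open>P\<close> the
  ideal \<open>P + (x)\<close> contains a power of \<open>\<beta>\<close>; multiplying two such
  powers shows that \<open>x * y\<close> in \<open>P\<close> would put a power of
  \<open>\<beta>\<close> into \<open>P\<close>.\<close>

lemma prime_ideal_avoiding_powers:
  assumes I: "is_ideal I" and \<beta>: "\<And>s. \<beta> ^ s \<notin> I"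
  obtains P where "is_prime_ideal P" "I \<subseteq> P" "\<beta> \<notin> P"
proof -
  define Q where "Q = {J. is_ideal J \<and> I \<subseteq> J \<and> (\<forall>s. \<beta> ^ s \<notin> J)}"
  have IQ: "I \<in> Q" using assms by (auto simp: Q_def)
  have "\<exists>M\<in>Q. \<forall>U\<in>Q. M \<subseteq> U \<longrightarrow> U = M"
  proof (rule subset_Zorn_nonempty)
    show "Q \<noteq> {}" using IQ by blast
  next
    fix C assume C: "C \<noteq> {}" "subset.chain Q C"
    then have CQ: "\<And>J. J \<in> C \<Longrightarrow> J \<in> Q" by (auto simp: subset.chain_def)
    have "is_ideal (\<Union>C)"
    proof (rule is_idealI)
      show "0 \<in> \<Union>C" using C(1) CQ is_ideal_0 by (fastforce simp: Q_def)
    next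
      fix x y assume "x \<in> \<Union>C" "y \<in> \<Union>C"
      then obtain J K where JK: "J \<in> C" "K \<in> C" "x \<in> J" "y \<in> K" by blast
      then have "J \<subseteq> K \<or> K \<subseteq> J" using C(2) by (auto simp: subset.chain_def)
      then show "x + y \<in> \<Union>C" using JK CQ is_ideal_add unfolding Q_def by blast
    next
      fix r x assume "x \<in> \<Union>C"
      then show "r * x \<in> \<Union>C" using CQ is_ideal_mult unfolding Q_def by blast
    qed
    then show "\<Union>C \<in> Q" using C(1) CQ unfolding Q_def by blast
  qed
  then obtain P where P: "P \<in> Q" and max: "\<And>U. U \<in> Q \<Longrightarrow> P \<subseteq> U \<Longrightarrow> U = P" by blast
  have Pi: "is_ideal P" and IP: "I \<subseteq> P" and Pb: "\<And>s. \<beta> ^ s \<notin> P" using P by (auto simp: Q_def)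
  have ex: "\<exists>s r p. p \<in> P \<and> \<beta> ^ s = p + r * x" if "x \<notin> P" for x
  proof (rule ccontr)
    assume *: "\<not> ?thesis"
    define U where "U = {p + r * x | p r. p \<in> P}"
    have "is_ideal U"
    proof (rule is_idealI)
      show "0 \<in> U" unfolding U_def using is_ideal_0[OF Pi] by (auto intro!: exI[of _ 0])
    next
      fix u v assume "u \<in> U" "v \<in> U"
      then obtain p r p' r' where "u = p + r * x" "v = p' + r' * x" "p \<in> P" "p' \<in> P"
        unfolding U_def by blast
      then have "u + v = (p + p') + (r + r') * x" "p + p' \<in> P"
        using is_ideal_add[OF Pi] by (auto simp: algebra_simps)
      then show "u + v \<in> U" unfolding U_def by blast
    next
      fix t u assume "u \<in> U"
      then obtain p r where "u = p + r * x" "p \<in> P"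
        unfolding U_def by blast
      then have "t * u = t * p + (t * r) * x" "t * p \<in> P"
        using is_ideal_mult[OF Pi] by (auto simp: algebra_simps)
      then show "t * u \<in> U" unfolding U_def by blast
    qed
    moreover have PU: "P \<subseteq> U"
    proof
      fix p assume "p \<in> P"
      then have "p = p + 0 * x" "p \<in> P" by auto
      then show "p \<in> U" unfolding U_def by blast
    qed
    ultimately have "U \<in> Q" using * IP unfolding Q_def U_def by blast
    then have "U = P" using max PU by blast
    moreover have "x = 0 + 1 * x" by simp
    then have "x \<in> U" unfolding U_def using is_ideal_0[OF Pi] by blast
    ultimately show False using that by blast
  qed
  have "x \<in> P \<or> y \<in> P" if xy: "x * y \<in> P" for x y
  proof (rule ccontr)
    assume "\<not> ?thesis"
    then obtain s r p s' r' p' where *: "p \<in> P" "\<beta> ^ s = p + r * x" "p' \<in> P" "\<beta> ^ s' = p' + r' * y"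
      using ex by metis
    have "\<beta> ^ (s + s') = (p' + r' * y) * p + (r * x) * p' + (r * r') * (x * y)"
      unfolding power_add * by (simp add: algebra_simps)
    also have "\<dots> \<in> P" using *(1,3) xy by (simp add: is_ideal_add[OF Pi] is_ideal_mult[OF Pi])
    finally show False using Pb by blast
  qed
  moreover have "1 \<notin> P" using Pb[of 0] by simp
  ultimately have "is_prime_ideal P" using Pi by (auto simp: is_prime_ideal_def)
  moreover have "\<beta> \<notin> P" using Pb[of 1] by simp
  ultimately show thesis using that IP by blast
qed

section \<open>Ring homomorphisms and evaluation of univariate polynomials\<close>

definition is_ring_hom :: "('a::comm_ring_1 \<Rightarrow> 'b::comm_ring_1) \<Rightarrow> bool" where
  "is_ring_hom h \<longleftrightarrow> h 1 = 1 \<and> (\<forall>x y. h (x + y) = h x + h y) \<and> (\<forall>x y. h (x * y) = h x * h y)"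

lemma is_ring_homI:
  assumes "h 1 = 1" "\<And>x y. h (x + y) = h x + h y" "\<And>x y. h (x * y) = h x * h y"
  shows "is_ring_hom h"
  using assms unfolding is_ring_hom_def by blast

lemma
  assumes "is_ring_hom h"
  shows hom_1: "h 1 = 1" and hom_add: "h (x + y) = h x + h y" and hom_mult: "h (x * y) = h x * h y"
    and hom_0: "h 0 = 0"
proof -
  show "h 1 = 1" "h (x + y) = h x + h y" "h (x * y) = h x * h y"
    using assms unfolding is_ring_hom_def by blast+
  have "h (0 + 0) = h 0 + h 0" using assms unfolding is_ring_hom_def by blast
  then show "h 0 = 0" by simp
qed

lemma hom_power: "is_ring_hom h \<Longrightarrow> h (x ^ n) = h x ^ n"
  by (induction n) (simp_all add: hom_1 hom_mult)

lemma hom_prod: "is_ring_hom h \<Longrightarrow> h (prod f A) = (\<Prod>x\<in>A. h (f x))"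
  by (induction A rule: infinite_finite_induct) (simp_all add: hom_1 hom_mult)

lemma is_ring_hom_comp: "is_ring_hom g \<Longrightarrow> is_ring_hom h \<Longrightarrow> is_ring_hom (g \<circ> h)"
  by (simp add: is_ring_hom_def)

lemma is_ideal_vimage:
  assumes "is_ring_hom h" "is_ideal I"
  shows "is_ideal (h -` I)"
  using assms by (auto intro!: is_idealI simp: hom_0 hom_add hom_mult is_ideal_0 is_ideal_add is_ideal_mult)

lemma is_prime_ideal_vimage:
  assumes "is_ring_hom h" "is_prime_ideal P"
  shows "is_prime_ideal (h -` P)"
  using assms is_ideal_vimage[of h P] by (auto simp: is_prime_ideal_def hom_mult hom_1)

definition eval_poly :: "('a::comm_ring_1 \<Rightarrow> 'b::comm_ring_1) \<Rightarrow> 'b \<Rightarrow> 'a poly \<Rightarrow> 'b" where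
  "eval_poly h b f = poly (map_poly h f) b"

lemma eval_poly_0 [simp]: "eval_poly h b 0 = 0"
  by (simp add: eval_poly_def)

lemma eval_poly_pCons:
  assumes "is_ring_hom h"
  shows "eval_poly h b (pCons a f) = h a + b * eval_poly h b f"
  using hom_0[OF assms] by (simp add: eval_poly_def map_poly_pCons)

lemma is_ring_hom_eval_poly:
  assumes h: "is_ring_hom h"
  shows "is_ring_hom (eval_poly h b)"
proof (rule is_ring_homI)
  note [simp] = eval_poly_pCons[OF h] hom_0[OF h] hom_1[OF h] hom_add[OF h] hom_mult[OF h]
  show "eval_poly h b 1 = 1" unfolding one_pCons by simp
  have add: "eval_poly h b (f + g) = eval_poly h b f + eval_poly h b g" for f g
  proof (induction f g rule: poly_induct2)
    case (pCons a p c q)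
    then show ?case by (simp add: algebra_simps)
  qed simp
  have smult: "eval_poly h b (smult a g) = h a * eval_poly h b g" for a g
    by (induction g) (simp_all add: algebra_simps)
  show "eval_poly h b (f + g) = eval_poly h b f + eval_poly h b g" for f g by (rule add)
  show "eval_poly h b (f * g) = eval_poly h b f * eval_poly h b g" for f g
    by (induction f) (simp_all add: add smult algebra_simps)
qed

lemma hom_eval_poly:
  assumes "is_ring_hom g" "is_ring_hom h"
  shows "g (eval_poly h b f) = eval_poly (g \<circ> h) (g b) f"
  by (induction f)
    (simp_all add: eval_poly_pCons[OF assms(2)] eval_poly_pCons[OF is_ring_hom_comp[OF assms], unfolded comp_def]
      hom_0[OF assms(1)] hom_add[OF assms(1)] hom_mult[OF assms(1)])

section \<open>The ascending chain condition for polynomial rings\<close>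

text \<open>Noetherianity is phrased by chains because it is applied to a chain, that of the ideals
  of elements killed modulo \<open>J\<close> by the k-th powers of the variables.\<close>

definition acc_ideals :: "'a::comm_ring_1 itself \<Rightarrow> bool" where
  "acc_ideals _ \<longleftrightarrow>
     (\<forall>I::nat \<Rightarrow> 'a set. (\<forall>n. is_ideal (I n)) \<and> mono I \<longrightarrow> (\<exists>N. \<forall>n\<ge>N. I n = I N))"

lemma acc_ideals_field: "acc_ideals TYPE('a::field)"
  unfolding acc_ideals_def
proof (intro allI impI)
  fix I :: "nat \<Rightarrow> 'a set"
  assume I: "(\<forall>n. is_ideal (I n)) \<and> mono I"
  have unit: "I n = UNIV" if "x \<in> I n" "x \<noteq> 0" for x n
  proof -
    have "y \<in> I n" for y
      using is_ideal_mult[of "I n" x "y / x"] I that by simp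
    then show ?thesis by blast
  qed
  show "\<exists>N. \<forall>n\<ge>N. I n = I N"
  proof (cases "\<exists>n. \<exists>x\<in>I n. x \<noteq> 0")
    case True
    then obtain N where N: "I N = UNIV" using unit by blast
    then have "\<forall>n\<ge>N. I n = I N" using I by (metis monoD top.extremum_unique)
    then show ?thesis by blast
  next
    case False
    then have "I n = {0}" for n using I is_ideal_0 by blast
    then show ?thesis by simp
  qed
qed

text \<open>The degree is at most \<open>d\<close>, not exactly \<open>d\<close>: this admits the
  coefficient 0, so that the set is an ideal and grows with \<open>d\<close>.\<close>

definition lead_coeffs :: "'a::comm_ring_1 poly set \<Rightarrow> nat \<Rightarrow> 'a set" where
  "lead_coeffs I d = {coeff f d | f. f \<in> I \<and> degree f \<le> d}"

lemma is_ideal_lead_coeffs: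
  assumes I: "is_ideal I"
  shows "is_ideal (lead_coeffs I d)"
proof (rule is_idealI)
  show "0 \<in> lead_coeffs I d"
    unfolding lead_coeffs_def using is_ideal_0[OF I] by (auto intro!: exI[of _ 0])
next
  fix x y assume "x \<in> lead_coeffs I d" "y \<in> lead_coeffs I d"
  then obtain f g where "x = coeff f d" "y = coeff g d" "f \<in> I" "g \<in> I" "degree f \<le> d" "degree g \<le> d"
    unfolding lead_coeffs_def by blast
  then have "x + y = coeff (f + g) d" "f + g \<in> I" "degree (f + g) \<le> d"
    using is_ideal_add[OF I] degree_add_le by auto
  then show "x + y \<in> lead_coeffs I d" unfolding lead_coeffs_def by blast
next
  fix r x assume "x \<in> lead_coeffs I d"
  then obtain f where "x = coeff f d" "f \<in> I" "degree f \<le> d"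
    unfolding lead_coeffs_def by blast
  then have "r * x = coeff (smult r f) d" "smult r f \<in> I" "degree (smult r f) \<le> d"
    using is_ideal_mult[OF I, of f "[:r:]"] order.trans[OF degree_smult_le] by auto
  then show "r * x \<in> lead_coeffs I d" unfolding lead_coeffs_def by blast
qed

lemma lead_coeffs_Suc:
  assumes I: "is_ideal I"
  shows "lead_coeffs I d \<subseteq> lead_coeffs I (Suc d)"
proof
  fix x assume "x \<in> lead_coeffs I d"
  then obtain f where "x = coeff f d" "f \<in> I" "degree f \<le> d"
    unfolding lead_coeffs_def by blast
  then have "x = coeff (pCons 0 f) (Suc d)" "pCons 0 f \<in> I" "degree (pCons 0 f) \<le> Suc d"
    using is_ideal_mult[OF I, of f "[:0,1:]"] order.trans[OF degree_pCons_le] by auto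
  then show "x \<in> lead_coeffs I (Suc d)" unfolding lead_coeffs_def by blast
qed

lemma lead_coeffs_mono:
  assumes "is_ideal J" "I \<subseteq> J" "d \<le> e"
  shows "lead_coeffs I d \<subseteq> lead_coeffs J e"
proof -
  have "lead_coeffs I d \<subseteq> lead_coeffs J d" using assms(2) unfolding lead_coeffs_def by blast
  also have "\<dots> \<subseteq> lead_coeffs J e"
    by (rule lift_Suc_mono_le[of "lead_coeffs J"]) (use lead_coeffs_Suc assms in auto)
  finally show ?thesis .
qed

text \<open>Subtracting from an element of \<open>J\<close> an element of \<open>I\<close> with the
  same top coefficient lowers the degree, and the difference stays in \<open>J\<close>.\<close>

lemma ideal_eqI_lead_coeffs:
  assumes I: "is_ideal I" and J: "is_ideal J" and "I \<subseteq> J"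
    and lead: "\<And>d. lead_coeffs J d \<subseteq> lead_coeffs I d"
  shows "I = J"
proof -
  have "f \<in> I" if "f \<in> J" "degree f < n" for f n
    using that
  proof (induction n arbitrary: f)
    case (Suc n)
    then have "coeff f n \<in> lead_coeffs J n" unfolding lead_coeffs_def by auto
    then have "coeff f n \<in> lead_coeffs I n" using lead by blast
    then obtain g where g: "g \<in> I" "degree g \<le> n" "coeff g n = coeff f n"
      unfolding lead_coeffs_def by force
    then have "f - g \<in> J" using Suc.prems \<open>I \<subseteq> J\<close> is_ideal_diff[OF J] by blast
    moreover have "f - g = 0 \<or> degree (f - g) < n"
      using Suc.prems g by (intro eq_zero_or_degree_less degree_diff_le) auto
    ultimately have "f - g \<in> I" using Suc.IH is_ideal_0[OF I] by auto
    then show ?case using is_ideal_add[OF I g(1)] by force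
  qed simp
  then show ?thesis using \<open>I \<subseteq> J\<close> by blast
qed

text \<open>Hilbert's basis theorem. The leading coefficient ideals \<open>L n d\<close> increase in
  both indices. Stability of the diagonal from \<open>N\<close> on settles all degrees
  \<open>d \<ge> N\<close> at once, which leaves finitely many columns \<open>d < N\<close> to
  stabilize separately.\<close>

theorem acc_ideals_poly:
  assumes acc: "acc_ideals TYPE('a::comm_ring_1)"
  shows "acc_ideals TYPE('a poly)"
  unfolding acc_ideals_def
proof (intro allI impI)
  fix I :: "nat \<Rightarrow> 'a poly set"
  assume "(\<forall>n. is_ideal (I n)) \<and> mono I"
  then have I: "\<And>n. is_ideal (I n)" and mono: "\<And>m n. m \<le> n \<Longrightarrow> I m \<subseteq> I n"
    by (auto simp: monoD)
  define L where "L n d = lead_coeffs (I n) d" for n d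
  have L: "is_ideal (L n d)" for n d unfolding L_def by (rule is_ideal_lead_coeffs[OF I])
  have Lmono: "L m d \<subseteq> L n e" if "m \<le> n" "d \<le> e" for m n d e
    unfolding L_def by (rule lead_coeffs_mono[OF I mono[OF that(1)] that(2)])
  have "\<exists>N. \<forall>n\<ge>N. L n n = L N N"
    using acc[unfolded acc_ideals_def, rule_format, of "\<lambda>n. L n n"] L Lmono
    by (auto simp: mono_def)
  then obtain N where N: "\<And>n. n \<ge> N \<Longrightarrow> L n n = L N N" by blast
  have "\<exists>M. \<forall>n\<ge>M. L n d = L M d" for d
    using acc[unfolded acc_ideals_def, rule_format, of "\<lambda>n. L n d"] L Lmono
    by (auto simp: mono_def)
  then obtain M where M: "\<And>d n. n \<ge> M d \<Longrightarrow> L n d = L (M d) d" by metis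
  define K where "K = max N (Max (insert 0 (M ` {..<N})))"
  have K: "N \<le> K" "\<And>d. d < N \<Longrightarrow> M d \<le> K"
    unfolding K_def by (auto simp: le_max_iff_disj)
  have "I n = I K" if "K \<le> n" for n
  proof (rule ideal_eqI_lead_coeffs[symmetric])
    show "I K \<subseteq> I n" using mono that by blast
    fix d
    have "L n d \<subseteq> L K d"
    proof (cases "d < N")
      case True
      then show ?thesis using M[of d n] M[of d K] K(2)[of d] that by simp
    next
      case False
      \<comment> \<open>In high degree both ideals are squeezed between two entries equal to the
        diagonal value \<open>L N N\<close>.\<close>
      have "L n d \<subseteq> L (max n d) (max n d)" by (rule Lmono) auto
      also have "\<dots> = L N N" using False by (intro N) auto
      also have "\<dots> \<subseteq> L K d" using False K(1) by (intro Lmono) auto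
      finally show ?thesis .
    qed
    then show "lead_coeffs (I n) d \<subseteq> lead_coeffs (I K) d" unfolding L_def .
  qed (rule I)+
  then show "\<exists>N. \<forall>n\<ge>N. I n = I N" by blast
qed

lemma acc_ideals_surj:
  fixes h :: "'a::comm_ring_1 \<Rightarrow> 'b::comm_ring_1"
  assumes h: "is_ring_hom h" "surj h" and acc: "acc_ideals TYPE('a)"
  shows "acc_ideals TYPE('b)"
  unfolding acc_ideals_def
proof (intro allI impI)
  fix I :: "nat \<Rightarrow> 'b set"
  assume I: "(\<forall>n. is_ideal (I n)) \<and> mono I"
  then have "(\<forall>n. is_ideal (h -` I n)) \<and> mono (\<lambda>n. h -` I n)"
    using is_ideal_vimage[OF h(1)] by (auto simp: mono_def subset_iff)
  with acc obtain N where "\<forall>n\<ge>N. h -` I n = h -` I N"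
    unfolding acc_ideals_def by (metis (no_types, lifting))
  then have "\<forall>n\<ge>N. I n = I N" using surj_image_vimage_eq[OF h(2)] by metis
  then show "\<exists>N. \<forall>n\<ge>N. I n = I N" by blast
qed

section \<open>Points of prime ideals over algebraically closed fields\<close>

text \<open>A form of the Nullstellensatz that survives adjoining a variable. The element
  \<open>\<beta>\<close> is what makes the induction run: it allows a point to be chosen at which
  prescribed leading coefficients do not vanish.\<close>

definition has_points :: "('a::comm_ring_1 \<Rightarrow> 'l::comm_ring_1) set \<Rightarrow> bool" where
  "has_points H \<longleftrightarrow>
     (\<forall>P \<beta>. is_prime_ideal P \<and> \<beta> \<notin> P \<longrightarrow> (\<exists>h\<in>H. (\<forall>x\<in>P. h x = 0) \<and> h \<beta> \<noteq> 0))"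

lemma prime_ideal_power:
  assumes "is_prime_ideal P" "x \<notin> P"
  shows "x ^ n \<notin> P"
  using assms by (induction n) (auto simp: is_prime_ideal_def)

lemma alg_closed_nonroot:
  fixes g :: "'l::alg_closed_field poly"
  assumes "g \<noteq> 0"
  obtains b where "poly g b \<noteq> 0"
proof (cases "degree g = 0")
  case True
  then obtain c where "g = [:c:]" by (rule degree_eq_zeroE)
  with assms that[of 0] show thesis by simp
next
  case False
  \<comment> \<open>A root of \<open>g + 1\<close> is a point where \<open>g\<close> takes the value
    -1.\<close>
  then have "degree (g + 1) > 0" by (simp add: degree_add_eq_left)
  then obtain b where "poly (g + 1) b = 0" using alg_closed_imp_poly_has_root by blast
  then have "poly g b \<noteq> 0" by auto
  with that show thesis .
qed

lemma coeffs_in_ideal_mult: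
  assumes "is_ideal I" "\<And>i. coeff h i \<in> I"
  shows "coeff (g * h) i \<in> I"
  unfolding coeff_mult by (intro is_ideal_sum is_ideal_mult assms)

lemma coeffs_in_contraction:
  assumes P: "is_ideal P" and "\<And>i. [:coeff g i:] \<in> P"
  shows "g \<in> P"
  using assms(2)
proof (induction g)
  case 0
  then show ?case using is_ideal_0[OF P] by simp
next
  case (pCons a g)
  have "[:a:] \<in> P" using pCons.prems[of 0] by simp
  moreover have "g \<in> P" using pCons.prems[of "Suc _"] by (intro pCons.IH) simp
  ultimately have "[:a:] + [:0, 1:] * g \<in> P" by (intro is_ideal_add is_ideal_mult P)
  then show ?case by simp
qed

text \<open>Cut \<open>g\<close> off above its last coefficient outside \<open>I\<close>. This makes
  the leading coefficient nonzero modulo \<open>I\<close> while changing \<open>g\<close> only by a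
  polynomial with coefficients in \<open>I\<close>.\<close>

lemma truncate_mod_ideal:
  assumes I: "is_ideal I" and g: "\<not> (\<forall>i. coeff g i \<in> I)"
  obtains g' where "degree g' \<le> degree g" "lead_coeff g' \<notin> I" "\<And>i. coeff (g - g') i \<in> I"
proof -
  let ?B = "{i. coeff g i \<notin> I}"
  have sub: "?B \<subseteq> {..degree g}" using coeff_eq_0[of g] is_ideal_0[OF I] by (force simp: not_le[symmetric])
  then have fin: "finite ?B" by (rule finite_subset) simp
  have B: "?B \<noteq> {}" using g by blast
  define m where "m = Max ?B"
  have m: "coeff g m \<notin> I" using Max_in[OF fin B] by (simp add: m_def)
  have above: "coeff g i \<in> I" if "i > m" for i using Max_ge[OF fin, of i] that by (force simp: m_def)
  let ?g = "poly_cutoff (Suc m) g"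
  have "coeff ?g m \<noteq> 0" using m is_ideal_0[OF I] by (auto simp: coeff_poly_cutoff)
  moreover have "degree ?g \<le> m" by (rule degree_le) (simp add: coeff_poly_cutoff)
  ultimately have deg: "degree ?g = m" using le_degree[of ?g m] by simp
  show thesis
  proof (rule that[of ?g])
    show "degree ?g \<le> degree g" using deg m is_ideal_0[OF I] le_degree[of g m] by force
    show "lead_coeff ?g \<notin> I" using deg m by (simp add: coeff_poly_cutoff)
    show "coeff (g - ?g) i \<in> I" for i
      using above[of i] is_ideal_0[OF I] by (auto simp: coeff_poly_cutoff)
  qed
qed

lemma pseudo_division:
  fixes f g :: "'a::comm_ring_1 poly"
  assumes "degree g > 0"
  obtains s q r where "smult (lead_coeff g ^ s) f = g * q + r" "degree r < degree g"
proof -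
  obtain q r where qr: "pseudo_divmod f g = (q, r)" by fastforce
  have "g \<noteq> 0" using assms by auto
  from pseudo_divmod[OF this qr] assms show thesis by (intro that) auto
qed

lemma eval_poly_eq_0:
  assumes "\<And>i. h (coeff r i) = 0"
  shows "eval_poly h b r = 0"
proof -
  have "h 0 = 0" using assms[of "Suc (degree r)"] by (simp add: coeff_eq_0)
  then have "map_poly h r = 0" by (intro poly_eqI) (simp add: coeff_map_poly assms)
  then show ?thesis by (simp add: eval_poly_def)
qed

text \<open>Let \<open>\<pp>\<close> be the contraction of \<open>P\<close> to the coefficients. If \<open>P\<close> is larger than the extension of \<open>\<pp>\<close>,
  choose \<open>f\<close> of least degree among the elements of \<open>P\<close> with leading coefficient \<open>l\<close> outside \<open>\<pp>\<close>. By
  pseudo-division, over a point of \<open>\<pp>\<close> with \<open>l \<noteq> 0\<close> every root of \<open>f\<close> is a point of \<open>P\<close>. An element of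
  least degree in \<open>P + (\<beta>)\<close> outside \<open>P\<close> is a constant \<open>c\<close>, and \<open>c \<noteq> 0\<close> at the point forces
  \<open>\<beta> \<noteq> 0\<close> there.\<close>

theorem has_points_poly:
  fixes H :: "('a::comm_ring_1 \<Rightarrow> 'l::alg_closed_field) set"
  assumes hom: "\<And>h. h \<in> H \<Longrightarrow> is_ring_hom h" and H: "has_points H"
  shows "has_points {eval_poly h b | h b. h \<in> H}"
  unfolding has_points_def
proof (intro allI impI)
  fix P :: "'a poly set" and \<beta>
  assume "is_prime_ideal P \<and> \<beta> \<notin> P"
  then have P: "is_prime_ideal P" and \<beta>: "\<beta> \<notin> P" by auto
  have Pi: "is_ideal P" using P by (simp add: is_prime_ideal_def)
  note Pprime = P[unfolded is_prime_ideal_def, THEN conjunct2, THEN conjunct2, rule_format]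
  define \<pp> where "\<pp> = (\<lambda>a. [:a:]) -` P"
  have "is_ring_hom (\<lambda>a::'a. [:a:])" by (rule is_ring_homI) (simp_all add: one_pCons)
  then have \<pp>: "is_prime_ideal \<pp>" unfolding \<pp>_def using P by (rule is_prime_ideal_vimage)
  then have \<pp>i: "is_ideal \<pp>" by (simp add: is_prime_ideal_def)
  note \<pp>prime = \<pp>[unfolded is_prime_ideal_def, THEN conjunct2, THEN conjunct2, rule_format]
  have ext: "g \<in> P" if "\<And>i. coeff g i \<in> \<pp>" for g
    using that coeffs_in_contraction[OF Pi] by (auto simp: \<pp>_def)
  have pt: "\<exists>h\<in>H. (\<forall>x\<in>\<pp>. h x = 0) \<and> h \<alpha> \<noteq> 0" if "\<alpha> \<notin> \<pp>" for \<alpha>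
    using H \<pp> that unfolding has_points_def by blast
  show "\<exists>h\<in>{eval_poly h b | h b. h \<in> H}. (\<forall>x\<in>P. h x = 0) \<and> h \<beta> \<noteq> 0"
  proof (cases "\<forall>g\<in>P. \<forall>i. coeff g i \<in> \<pp>")
    case True
    \<comment> \<open>Here \<open>P\<close> is the extension of \<open>\<pp>\<close>, so a point of
      \<open>\<pp>\<close> at which some coefficient of \<open>\<beta>\<close> survives may be
      completed by any \<open>b\<close> that is not a root of the image of
      \<open>\<beta>\<close>.\<close>
    obtain i where "coeff \<beta> i \<notin> \<pp>" using ext \<beta> by blast
    then obtain h where h: "h \<in> H" "\<forall>x\<in>\<pp>. h x = 0" "h (coeff \<beta> i) \<noteq> 0" using pt by blast
    then have "map_poly h \<beta> \<noteq> 0" using hom_0[OF hom[OF h(1)]] coeff_map_poly[of h \<beta> i] by auto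
    then obtain b where "eval_poly h b \<beta> \<noteq> 0"
      unfolding eval_poly_def by (rule alg_closed_nonroot)
    moreover have "eval_poly h b g = 0" if "g \<in> P" for g
      using True that h(2) by (intro eval_poly_eq_0) blast
    ultimately show ?thesis using h(1) by blast
  next
    case False
    let ?A = "{f \<in> P. lead_coeff f \<notin> \<pp>}"
    have trA: "\<exists>f\<in>?A. degree f \<le> degree g" if g: "g \<in> P" "\<not> (\<forall>i. coeff g i \<in> \<pp>)" for g
    proof -
      obtain g' where g': "degree g' \<le> degree g" "lead_coeff g' \<notin> \<pp>" "\<And>i. coeff (g - g') i \<in> \<pp>"
        using truncate_mod_ideal[OF \<pp>i g(2)] by blast
      have "g - (g - g') \<in> P" using is_ideal_diff[OF Pi g(1) ext[OF g'(3)]] .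
      with g' show ?thesis by auto
    qed
    from False obtain f0 where "f0 \<in> ?A" using trA by blast
    then obtain f where f: "f \<in> ?A" and fmin: "\<And>g. g \<in> ?A \<Longrightarrow> degree f \<le> degree g"
      using ex_has_least_nat[of "\<lambda>f. f \<in> ?A" f0 degree] by blast
    define d where "d = degree f"
    define l where "l = lead_coeff f"
    have l: "l \<notin> \<pp>" and fP: "f \<in> P" using f by (auto simp: l_def)
    have low: "coeff g i \<in> \<pp>" if "g \<in> P" "degree g < d" for g i
      using trA[OF that(1)] fmin that(2) unfolding d_def by fastforce
    have d: "d > 0"
    proof (rule ccontr)
      assume "\<not> d > 0"
      then have "f = [:l:]" using degree_eq_zeroE[of f] unfolding d_def l_def by force
      then show False using fP l unfolding \<pp>_def by simp
    qed
    have lP: "[:l:] ^ s \<notin> P" for s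
      using prime_ideal_power[OF P] l by (simp add: \<pp>_def)
    have smult_pow: "smult (c ^ s) g = [:c:] ^ s * g" for c :: 'a and s g
      by (simp add: poly_const_pow)
    have root: "\<exists>b. \<forall>g\<in>P. eval_poly h b g = 0" if h: "h \<in> H" "\<forall>x\<in>\<pp>. h x = 0" "h l \<noteq> 0" for h
    proof -
      note hom = hom[OF h(1)]
      note homp = is_ring_hom_eval_poly[OF hom]
      have "coeff (map_poly h f) d \<noteq> 0"
        using h(3) hom_0[OF hom] by (simp add: coeff_map_poly l_def d_def)
      then have "degree (map_poly h f) > 0" using d le_degree by fastforce
      then obtain b where b: "eval_poly h b f = 0"
        unfolding eval_poly_def using alg_closed_imp_poly_has_root by blast
      have "eval_poly h b g = 0" if g: "g \<in> P" for g
      proof -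
        obtain s q r where qr: "smult (l ^ s) g = f * q + r" "degree r < d"
          using pseudo_division[of f g] d unfolding d_def l_def by metis
        have "r = [:l:] ^ s * g - q * f" using qr(1) by (simp add: smult_pow algebra_simps)
        then have "r \<in> P" using g fP by (simp only:) (intro is_ideal_diff is_ideal_mult Pi)
        \<comment> \<open>The remainder lies in \<open>P\<close> and has degree below the minimal
          degree \<open>d\<close>, so all its coefficients lie in \<open>\<pp>\<close> and vanish at
          \<open>h\<close>.\<close>
        then have "eval_poly h b r = 0"
          using low qr(2) h(2) by (intro eval_poly_eq_0) blast
        then have "eval_poly h b ([:l:] ^ s * g) = 0"
          using qr(1) b by (simp add: smult_pow[symmetric] hom_add[OF homp] hom_mult[OF homp] del: smult_pow)
        then have "h l ^ s * eval_poly h b g = 0"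
          by (simp add: hom_mult[OF homp] hom_power[OF homp] eval_poly_pCons[OF hom])
        then show ?thesis using h(3) by simp
      qed
      then show ?thesis by blast
    qed
    define Q where "Q = {u * \<beta> + w | u w. w \<in> P}"
    have Qi: "is_ideal Q"
    proof (rule is_idealI)
      have "0 = 0 * \<beta> + 0" by simp
      then show "0 \<in> Q" unfolding Q_def using is_ideal_0[OF Pi] by blast
    next
      fix y z assume "y \<in> Q" "z \<in> Q"
      then obtain u w u' w' where "y = u * \<beta> + w" "z = u' * \<beta> + w'" "w \<in> P" "w' \<in> P"
        unfolding Q_def by blast
      then have "y + z = (u + u') * \<beta> + (w + w')" "w + w' \<in> P"
        using is_ideal_add[OF Pi] by (auto simp: algebra_simps)
      then show "y + z \<in> Q" unfolding Q_def by blast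
    next
      fix r y assume "y \<in> Q"
      then obtain u w where "y = u * \<beta> + w" "w \<in> P" unfolding Q_def by blast
      then have "r * y = (r * u) * \<beta> + r * w" "r * w \<in> P"
        using is_ideal_mult[OF Pi] by (simp_all add: distrib_left mult.assoc)
      then show "r * y \<in> Q" unfolding Q_def by blast
    qed
    have PQ: "w \<in> Q" if "w \<in> P" for w
    proof -
      have "w = 0 * \<beta> + w" by simp
      with that show ?thesis unfolding Q_def by blast
    qed
    have "\<beta> = 1 * \<beta> + 0" by simp
    then have \<beta>Q: "\<beta> \<in> Q" unfolding Q_def using is_ideal_0[OF Pi] by blast
    let ?B = "{g \<in> Q. g \<notin> P \<and> lead_coeff g \<notin> \<pp>}"
    have trB: "\<exists>g\<in>?B. degree g \<le> degree r" if "r \<in> Q" "r \<notin> P" for r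
    proof -
      have "\<not> (\<forall>i. coeff r i \<in> \<pp>)" using ext that by blast
      then obtain g where g: "degree g \<le> degree r" "lead_coeff g \<notin> \<pp>" "\<And>i. coeff (r - g) i \<in> \<pp>"
        using truncate_mod_ideal[OF \<pp>i] by blast
      have rg: "r - g \<in> P" using g(3) by (rule ext)
      have "r - (r - g) \<in> Q" using is_ideal_diff[OF Qi that(1) PQ[OF rg]] .
      moreover have "g \<notin> P" using is_ideal_add[OF Pi rg, of g] that(2) by auto
      ultimately show ?thesis using g by auto
    qed
    obtain g0 where "g0 \<in> ?B" using trB[OF \<beta>Q \<beta>] by blast
    then obtain g where g: "g \<in> ?B" and gmin: "\<And>r. r \<in> ?B \<Longrightarrow> degree g \<le> degree r"
      using ex_has_least_nat[of "\<lambda>f. f \<in> ?B" g0 degree] by blast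
    then have gQ: "g \<in> Q" and gP: "g \<notin> P" and lg: "lead_coeff g \<notin> \<pp>" by auto
    have gmin': "degree g \<le> degree r" if "r \<in> Q" "r \<notin> P" for r
      using trB[OF that] gmin by (meson order.trans)
    \<comment> \<open>The remainder of \<open>\<beta>\<close> by \<open>f\<close> lies in
      \<open>Q\<close> but not in \<open>P\<close>, and it competes with \<open>g\<close> for the
      least degree.\<close>
    have gd: "degree g < d"
    proof -
      obtain s q r where qr: "smult (l ^ s) \<beta> = f * q + r" "degree r < d"
        using pseudo_division[of f \<beta>] d unfolding d_def l_def by metis
      then have r: "r = [:l:] ^ s * \<beta> - q * f" by (simp add: smult_pow algebra_simps)
      have "r \<in> Q" unfolding r by (intro is_ideal_diff is_ideal_mult Qi \<beta>Q PQ fP)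
      moreover have "r \<notin> P"
      proof
        assume "r \<in> P"
        then have "r + q * f \<in> P" by (intro is_ideal_add is_ideal_mult Pi fP)
        then have "[:l:] ^ s * \<beta> \<in> P" by (simp add: r)
        then show False using Pprime lP \<beta> by blast
      qed
      ultimately show ?thesis using gmin' qr(2) by fastforce
    qed
    \<comment> \<open>Otherwise divide \<open>f\<close> by \<open>g\<close>. The remainder is too
      small to lie outside \<open>P\<close>, so \<open>g * q\<close> lies in \<open>P\<close>, hence
      so does \<open>q\<close>. Once the coefficients of \<open>q\<close> are known to lie in
      \<open>\<pp>\<close>, the coefficient at \<open>d\<close> puts a power of the leading
      coefficient of \<open>g\<close> times \<open>l\<close> into \<open>\<pp>\<close>, a
      contradiction.\<close>
    have "degree g = 0"
    proof (rule ccontr)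
      assume "degree g \<noteq> 0"
      then obtain s q r where qr: "smult (lead_coeff g ^ s) f = g * q + r" "degree r < degree g"
        using pseudo_division[of g f] by blast
      then have r: "r = [:lead_coeff g:] ^ s * f - q * g" by (simp add: smult_pow algebra_simps)
      have "r \<in> Q" unfolding r by (intro is_ideal_diff is_ideal_mult Qi gQ PQ fP)
      then have rP: "r \<in> P" using gmin' qr(2) by fastforce
      have "[:lead_coeff g:] ^ s * f - r \<in> P" by (intro is_ideal_diff is_ideal_mult Pi fP rP)
      then have "q * g \<in> P" by (simp add: r)
      then have qP: "q \<in> P" using Pprime gP by blast
      \<comment> \<open>If not, the truncation \<open>q'\<close> has degree at least
        \<open>d\<close> by minimality of \<open>f\<close>. Then modulo \<open>\<pp>\<close> the
        product \<open>g * q\<close> has degree greater than \<open>d\<close>, although it equals a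
        multiple of \<open>f\<close> minus \<open>r\<close>.\<close>
      have q\<pp>: "coeff q i \<in> \<pp>" for i
      proof (rule ccontr)
        assume "coeff q i \<notin> \<pp>"
        then obtain q' where q': "degree q' \<le> degree q" "lead_coeff q' \<notin> \<pp>" "\<And>i. coeff (q - q') i \<in> \<pp>"
          using truncate_mod_ideal[OF \<pp>i, of q] by blast
        have "q - (q - q') \<in> P" by (rule is_ideal_diff[OF Pi qP ext[OF q'(3)]])
        then have dq: "d \<le> degree q'" using fmin q'(2) unfolding d_def by simp
        let ?k = "degree g + degree q'"
        have k: "?k > d" using dq \<open>degree g \<noteq> 0\<close> by simp
        have "coeff f ?k = 0" "coeff r ?k = 0"
          using k qr(2) gd by (auto intro!: coeff_eq_0 simp: d_def)
        then have "coeff (g * q) ?k = 0" using arg_cong[OF qr(1), of "\<lambda>f. coeff f ?k"] by simp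
        moreover have "coeff (g * (q - q')) ?k \<in> \<pp>" using coeffs_in_ideal_mult[OF \<pp>i q'(3)] .
        ultimately have "- coeff (g * q') ?k \<in> \<pp>" by (simp add: right_diff_distrib)
        then have "coeff (g * q') ?k \<in> \<pp>" using is_ideal_uminus[OF \<pp>i] by fastforce
        then have "lead_coeff g * lead_coeff q' \<in> \<pp>" by (simp add: coeff_mult_degree_sum)
        then show False using \<pp>prime q'(2) lg by blast
      qed
      have "coeff r d = 0" using qr(2) gd by (intro coeff_eq_0) simp
      then have "lead_coeff g ^ s * l = coeff (g * q) d"
        using arg_cong[OF qr(1), of "\<lambda>f. coeff f d"] by (simp add: l_def d_def)
      also have "\<dots> \<in> \<pp>" by (rule coeffs_in_ideal_mult[OF \<pp>i q\<pp>])
      finally show False using \<pp>prime l prime_ideal_power[OF \<pp> lg] by blast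
    qed
    then obtain c where c: "g = [:c:]" by (rule degree_eq_zeroE)
    then have c\<pp>: "c \<notin> \<pp>" using lg by simp
    obtain u w where uw: "[:c:] = u * \<beta> + w" "w \<in> P" using gQ unfolding c Q_def by blast
    \<comment> \<open>The point must avoid the zeros of both factors: \<open>l\<close> so that
      \<open>f\<close> keeps a root over it, and \<open>c\<close> so that \<open>\<beta>\<close> is
      nonzero at that root.\<close>
    have "c * l \<notin> \<pp>" using \<pp>prime c\<pp> l by blast
    then obtain h where h: "h \<in> H" "\<forall>x\<in>\<pp>. h x = 0" "h (c * l) \<noteq> 0" using pt by blast
    note homh = hom[OF h(1)]
    have hc: "h c \<noteq> 0" "h l \<noteq> 0" using h(3) by (auto simp: hom_mult[OF homh])
    obtain b where b: "\<forall>g\<in>P. eval_poly h b g = 0" using root[OF h(1,2) hc(2)] by blast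
    have "h c = eval_poly h b u * eval_poly h b \<beta> + eval_poly h b w"
      using arg_cong[OF uw(1), of "eval_poly h b"]
      by (simp add: eval_poly_pCons[OF homh] hom_add[OF is_ring_hom_eval_poly[OF homh]]
        hom_mult[OF is_ring_hom_eval_poly[OF homh]])
    then have "eval_poly h b \<beta> \<noteq> 0" using hc(1) b uw(2) by auto
    then show ?thesis using b h(1) by blast
  qed
qed

section \<open>Evaluation of polynomials in four variables\<close>

abbreviation mconst :: "'k::zero \<Rightarrow> 'k poly4" where
  "mconst c \<equiv> Poly_Mapping.single 0 c"

definition mvar :: "4 \<Rightarrow> 'k::zero_neq_one poly4" where
  "mvar i = Poly_Mapping.single (Poly_Mapping.single i 1) 1"

lemma UNIV_4: "(UNIV :: 4 set) = {0, 1, 2, 3}"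
proof -
  have "card {0, 1, 2, 3 :: 4} = CARD(4)" by simp
  then show ?thesis by (metis card_eq_UNIV_imp_eq_UNIV finite)
qed

lemma poly_mapping_sum_singles:
  fixes f :: "'a \<Rightarrow>\<^sub>0 'b::comm_monoid_add"
  shows "f = (\<Sum>u\<in>Poly_Mapping.keys f. Poly_Mapping.single u (Poly_Mapping.lookup f u))"
proof (rule poly_mapping_eqI)
  fix v
  have "(\<Sum>u\<in>Poly_Mapping.keys f. Poly_Mapping.lookup f u when u = v) = Poly_Mapping.lookup f v"
    by (simp add: when_def in_keys_iff)
  then show "Poly_Mapping.lookup f v =
      Poly_Mapping.lookup (\<Sum>u\<in>Poly_Mapping.keys f. Poly_Mapping.single u (Poly_Mapping.lookup f u)) v"
    by (simp add: lookup_sum lookup_single)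
qed

lemma poly_mapping_single_induct [case_names zero single add]:
  fixes f :: "'a \<Rightarrow>\<^sub>0 'b::comm_monoid_add"
  assumes "P 0" "\<And>u c. P (Poly_Mapping.single u c)" "\<And>f g. P f \<Longrightarrow> P g \<Longrightarrow> P (f + g)"
  shows "P f"
proof -
  have "P (\<Sum>u\<in>A. Poly_Mapping.single u (Poly_Mapping.lookup f u))" for A
    by (induction A rule: infinite_finite_induct) (use assms in auto)
  then show ?thesis by (subst poly_mapping_sum_singles)
qed

lemma mvar_power: "mvar i ^ n = (Poly_Mapping.single (Poly_Mapping.single i n) 1 :: 'k::comm_ring_1 poly4)"
  by (induction n) (simp_all add: mvar_def mult_single flip: single_add)

lemma prod_single:
  "finite A \<Longrightarrow> (\<Prod>i\<in>A. Poly_Mapping.single (u i) 1) = (Poly_Mapping.single (\<Sum>i\<in>A. u i) 1 :: 'k::comm_ring_1 poly4)"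
  by (induction A rule: finite_induct) (simp_all add: mult_single)

lemma single_eq_mconst_mvar:
  "Poly_Mapping.single u c = mconst c * (\<Prod>i\<in>UNIV. mvar i ^ Poly_Mapping.lookup u i :: 'k::comm_ring_1 poly4)"
proof -
  have "(\<Sum>i\<in>UNIV. Poly_Mapping.single i (Poly_Mapping.lookup u i)) = u"
    by (rule poly_mapping_eqI) (simp add: lookup_sum lookup_single when_def)
  then show ?thesis by (simp add: mvar_power prod_single mult_single)
qed

text \<open>Covers evaluation at points over the algebraic closure as well as, with values in
  polynomials in one more variable, the substitution that defines \<open>taylor\<close>.\<close>

definition eval4 :: "('k::comm_ring_1 \<Rightarrow> 'b::comm_ring_1) \<Rightarrow> (4 \<Rightarrow> 'b) \<Rightarrow> 'k poly4 \<Rightarrow> 'b" where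
  "eval4 h x f = (\<Sum>u\<in>Poly_Mapping.keys f. h (Poly_Mapping.lookup f u) * (\<Prod>i\<in>UNIV. x i ^ Poly_Mapping.lookup u i))"

context
  fixes h :: "'k::comm_ring_1 \<Rightarrow> 'b::comm_ring_1"
  assumes h: "is_ring_hom h"
begin

lemma eval4_superset:
  assumes "finite A" "Poly_Mapping.keys f \<subseteq> A"
  shows "eval4 h x f = (\<Sum>u\<in>A. h (Poly_Mapping.lookup f u) * (\<Prod>i\<in>UNIV. x i ^ Poly_Mapping.lookup u i))"
  unfolding eval4_def
  by (rule sum.mono_neutral_left) (use assms in \<open>auto simp: in_keys_iff hom_0[OF h]\<close>)

lemma eval4_add: "eval4 h x (f + g) = eval4 h x f + eval4 h x g"
proof -
  let ?A = "Poly_Mapping.keys f \<union> Poly_Mapping.keys g"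
  have "eval4 h x f' = (\<Sum>u\<in>?A. h (Poly_Mapping.lookup f' u) * (\<Prod>i\<in>UNIV. x i ^ Poly_Mapping.lookup u i))"
    if "f' \<in> {f, g, f + g}" for f'
    using that keys_add[of f g] by (intro eval4_superset) auto
  then show ?thesis by (simp add: lookup_add hom_add[OF h] distrib_right sum.distrib)
qed

lemma eval4_0 [simp]: "eval4 h x 0 = 0"
  by (simp add: eval4_def)

lemma eval4_single: "eval4 h x (Poly_Mapping.single u c) = h c * (\<Prod>i\<in>UNIV. x i ^ Poly_Mapping.lookup u i)"
  by (subst eval4_superset[of "{u}"]) auto

lemma eval4_mconst [simp]: "eval4 h x (mconst c) = h c"
  by (simp add: eval4_single)

lemma eval4_mvar [simp]: "eval4 h x (mvar i) = x i"
proof -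
  have "(\<Prod>j\<in>UNIV. x j ^ Poly_Mapping.lookup (Poly_Mapping.single i 1) j) = (\<Prod>j\<in>UNIV. if j = i then x j else 1)"
    by (intro prod.cong) (auto simp: lookup_single when_def)
  then show ?thesis by (simp add: eval4_single mvar_def hom_1[OF h])
qed

lemma is_ring_hom_eval4: "is_ring_hom (eval4 h x)"
proof (rule is_ring_homI)
  show "eval4 h x 1 = 1" using eval4_mconst[of x 1] by (simp add: hom_1[OF h])
  show "eval4 h x (f + g) = eval4 h x f + eval4 h x g" for f g by (rule eval4_add)
  show "eval4 h x (f * g) = eval4 h x f * eval4 h x g" for f g
  proof (induction f rule: poly_mapping_single_induct)
    case (single u c)
    show ?case
    proof (induction g rule: poly_mapping_single_induct)
      case (single v d)
      show ?case
        by (simp add: mult_single eval4_single hom_mult[OF h] lookup_add power_add prod.distrib mult_ac)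
    qed (simp_all add: distrib_left eval4_add)
  qed (simp_all add: distrib_right eval4_add)
qed

end

lemma is_ring_hom_mconst: "is_ring_hom (mconst :: 'k::comm_ring_1 \<Rightarrow> _)"
  by (rule is_ring_homI) (simp_all add: single_add mult_single)

lemma is_ring_hom_to_ac: "is_ring_hom to_ac"
  by (rule is_ring_homI) simp_all

lemma eval_ac_eq_eval4: "eval_ac = eval4 to_ac"
  by (intro ext) (simp add: eval_ac_def eval4_def)

section \<open>Noetherianity and the Nullstellensatz in four variables\<close>

text \<open>Iterated univariate polynomials carry the inductions on the number of variables.
  Surjectivity then transfers the chain condition, and primes with their points are pulled back
  along the map.\<close>

definition poly4_of_nested :: "'k::field poly poly poly poly \<Rightarrow> 'k poly4" where
  "poly4_of_nested =
     eval_poly (eval_poly (eval_poly (eval_poly mconst (mvar 0)) (mvar 1)) (mvar 2)) (mvar 3)"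

lemma is_ring_hom_poly4_of_nested: "is_ring_hom poly4_of_nested"
  unfolding poly4_of_nested_def by (intro is_ring_hom_eval_poly is_ring_hom_mconst)

lemma surj_poly4_of_nested: "surj (poly4_of_nested :: _ \<Rightarrow> 'k::field poly4)"
proof -
  let ?h = "poly4_of_nested :: _ \<Rightarrow> 'k poly4"
  note hom = is_ring_hom_poly4_of_nested
  have var: "eval_poly h b [:0, 1:] = b" "eval_poly h b [:c:] = h c"
    if "is_ring_hom h" for h :: "'a::comm_ring_1 \<Rightarrow> 'k poly4" and b c
    by (simp_all add: eval_poly_pCons[OF that] hom_0[OF that] hom_1[OF that])
  note homs = is_ring_hom_eval_poly is_ring_hom_mconst
  have const: "mconst c \<in> range ?h" for c
    by (rule range_eqI[of _ _ "[:[:[:[:c:]:]:]:]"]) (simp add: poly4_of_nested_def var homs)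
  have "mvar 0 = ?h [:[:[:[:0, 1:]:]:]:]" "mvar 1 = ?h [:[:[:0, 1:]:]:]"
    "mvar 2 = ?h [:[:0, 1:]:]" "mvar 3 = ?h [:0, 1:]"
    by (simp_all add: poly4_of_nested_def var homs)
  then have "mvar i \<in> range ?h" for i
    using UNIV_4 by (metis UNIV_I insertE rangeI singletonD)
  then have v: "?h (inv_into UNIV ?h (mvar i)) = mvar i" for i by (rule f_inv_into_f)
  have "f \<in> range ?h" for f
  proof (induction f rule: poly_mapping_single_induct)
    case zero
    then show ?case using hom_0[OF hom] by (metis rangeI)
  next
    case (single u c)
    obtain c' where "mconst c = ?h c'" using const by blast
    then have "Poly_Mapping.single u c = ?h (c' * (\<Prod>i\<in>UNIV. inv_into UNIV ?h (mvar i) ^ Poly_Mapping.lookup u i))"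
      by (subst single_eq_mconst_mvar) (simp add: v hom_mult[OF hom] hom_prod[OF hom] hom_power[OF hom])
    then show ?case by blast
  next
    case (add f g)
    then obtain f' g' where "f = ?h f'" "g = ?h g'" by blast
    then have "f + g = ?h (f' + g')" by (simp add: hom_add[OF hom])
    then show ?case by blast
  qed
  then show ?thesis by blast
qed

lemma acc_ideals_poly4: "acc_ideals TYPE('k::field poly4)"
  by (rule acc_ideals_surj[OF is_ring_hom_poly4_of_nested surj_poly4_of_nested])
    (intro acc_ideals_poly acc_ideals_field)

lemma has_pointsD:
  assumes "has_points H" "is_prime_ideal P" "\<beta> \<notin> P"
  shows "\<exists>h\<in>H. (\<forall>x\<in>P. h x = 0) \<and> h \<beta> \<noteq> 0"
  using assms unfolding has_points_def by blast

text \<open>Base of the induction: the zero ideal is the only prime of a field, and a homomorphism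
  into a field kills no unit.\<close>

lemma has_points_field:
  assumes "is_ring_hom (h :: 'k::field \<Rightarrow> 'l::field)"
  shows "has_points {h}"
  unfolding has_points_def
proof (intro allI impI)
  fix P :: "'k set" and \<beta> assume *: "is_prime_ideal P \<and> \<beta> \<notin> P"
  then have P: "is_ideal P" "1 \<notin> P" by (auto simp: is_prime_ideal_def)
  then have "x = 0" if "x \<in> P" for x
    using is_ideal_mult[of P x "inverse x"] that by (cases "x = 0") auto
  moreover have "\<beta> \<noteq> 0" using * is_ideal_0 P by blast
  then have "h (\<beta> * inverse \<beta>) \<noteq> 0" using hom_1[OF assms] by simp
  then have "h \<beta> \<noteq> 0" by (auto simp: hom_mult[OF assms])
  ultimately show "\<exists>h\<in>{h}. (\<forall>x\<in>P. h x = 0) \<and> h \<beta> \<noteq> 0" using hom_0[OF assms] by auto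
qed

text \<open>If no power of \<open>\<beta>\<close> lies in \<open>I\<close>, some prime over
  \<open>I\<close> omits \<open>\<beta>\<close>, and a point of that prime with
  \<open>\<beta>\<close> nonzero contradicts the assumption on zeros. The ideal lives over
  \<open>K\<close>, its points over the algebraic closure.\<close>

theorem nullstellensatz4:
  fixes I :: "'k::field poly4 set"
  assumes I: "is_ideal I"
    and zeros: "\<And>x. (\<And>f. f \<in> I \<Longrightarrow> eval_ac x f = 0) \<Longrightarrow> eval_ac x \<beta> = 0"
  obtains s where "\<beta> ^ s \<in> I"
proof (rule ccontr)
  assume "\<not> thesis"
  then have "\<And>s. \<beta> ^ s \<notin> I" using that by blast
  then obtain P where P: "is_prime_ideal P" "I \<subseteq> P" "\<beta> \<notin> P"
    using prime_ideal_avoiding_powers[OF I] by blast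
  obtain \<beta>' where \<beta>': "\<beta> = poly4_of_nested \<beta>'" using surj_poly4_of_nested by blast
  let ?P = "poly4_of_nested -` P"
  let ?H0 = "{to_ac} :: ('k \<Rightarrow> 'k alg_closure) set"
  let ?H1 = "{eval_poly h b | h b. h \<in> ?H0}"
  let ?H2 = "{eval_poly h b | h b. h \<in> ?H1}"
  let ?H3 = "{eval_poly h b | h b. h \<in> ?H2}"
  let ?H4 = "{eval_poly h b | h b. h \<in> ?H3}"
  have hom: "\<And>h. h \<in> ?H0 \<Longrightarrow> is_ring_hom h" "\<And>h. h \<in> ?H1 \<Longrightarrow> is_ring_hom h"
    "\<And>h. h \<in> ?H2 \<Longrightarrow> is_ring_hom h" "\<And>h. h \<in> ?H3 \<Longrightarrow> is_ring_hom h"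
    by (auto intro!: is_ring_hom_to_ac is_ring_hom_eval_poly)
  have "has_points ?H0" by (rule has_points_field[OF is_ring_hom_to_ac])
  then have "has_points ?H4" by (intro has_points_poly hom)
  moreover have "is_prime_ideal ?P" "\<beta>' \<notin> ?P"
    using is_prime_ideal_vimage[OF is_ring_hom_poly4_of_nested P(1)] P(3) \<beta>' by auto
  ultimately have "\<exists>h\<in>?H4. (\<forall>x\<in>?P. h x = 0) \<and> h \<beta>' \<noteq> 0" by (rule has_pointsD)
  then obtain h where h: "h \<in> ?H4" "\<forall>x\<in>?P. h x = 0" "h \<beta>' \<noteq> 0" by (elim bexE conjE)
  then obtain b0 b1 b2 b3 where
    hb: "h = eval_poly (eval_poly (eval_poly (eval_poly to_ac b0) b1) b2) b3" by blast
  define x where "x i = (if i = 0 then b0 else if i = 1 then b1 else if i = 2 then b2 else b3)" for i :: 4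
  have ev: "is_ring_hom (eval4 to_ac x)" by (rule is_ring_hom_eval4[OF is_ring_hom_to_ac])
  have comp: "g \<circ> eval_poly h b = eval_poly (g \<circ> h) (g b)"
    if "is_ring_hom g" "is_ring_hom h" for g :: "'b::comm_ring_1 \<Rightarrow> 'c::comm_ring_1"
      and h :: "'a::comm_ring_1 \<Rightarrow> 'b" and b
    using hom_eval_poly[OF that] by (auto simp: fun_eq_iff)
  have "eval4 to_ac x \<circ> mconst = to_ac"
    by (simp add: fun_eq_iff eval4_mconst[OF is_ring_hom_to_ac])
  \<comment> \<open>The point supplied by the induction is four nested evaluations; comparing images
    of constants and variables identifies it with evaluation at \<open>x\<close>.\<close>
  then have h_eq: "eval4 to_ac x \<circ> poly4_of_nested = h"
    unfolding poly4_of_nested_def hb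
    by (simp add: comp ev is_ring_hom_eval_poly is_ring_hom_mconst eval4_mvar[OF is_ring_hom_to_ac] x_def)
  have "eval_ac x f = 0" if f: "f \<in> I" for f
  proof -
    obtain f' where "f = poly4_of_nested f'" using surj_poly4_of_nested by blast
    then show ?thesis using f P(2) h(2) h_eq by (auto simp: eval_ac_eq_eval4)
  qed
  then have "eval_ac x \<beta> = 0" by (rule zeros)
  then show False using h(3) h_eq \<beta>' by (auto simp: eval_ac_eq_eval4)
qed

section \<open>The Jacobian ideal of a smooth hypersurface\<close>

definition jacobian_ideal :: "'k::field poly4 \<Rightarrow> 'k poly4 set" where
  "jacobian_ideal F = {F * w + (\<Sum>j\<in>UNIV. partial_deriv j F * v j) | w v. True}"

lemma jacobian_idealI: "F * w + (\<Sum>j\<in>UNIV. partial_deriv j F * v j) \<in> jacobian_ideal F"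
  unfolding jacobian_ideal_def by blast

lemma is_ideal_jacobian_ideal: "is_ideal (jacobian_ideal F)"
proof (rule is_idealI)
  show "0 \<in> jacobian_ideal F" using jacobian_idealI[of F 0 "\<lambda>_. 0"] by simp
next
  fix x y assume "x \<in> jacobian_ideal F" "y \<in> jacobian_ideal F"
  then obtain w v w' v' where "x = F * w + (\<Sum>j\<in>UNIV. partial_deriv j F * v j)"
    "y = F * w' + (\<Sum>j\<in>UNIV. partial_deriv j F * v' j)"
    unfolding jacobian_ideal_def by blast
  then have "x + y = F * (w + w') + (\<Sum>j\<in>UNIV. partial_deriv j F * (v j + v' j))"
    by (simp add: distrib_left sum.distrib)
  also have "\<dots> \<in> jacobian_ideal F" by (rule jacobian_idealI)
  finally show "x + y \<in> jacobian_ideal F" .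
next
  fix r x assume "x \<in> jacobian_ideal F"
  then obtain w v where "x = F * w + (\<Sum>j\<in>UNIV. partial_deriv j F * v j)"
    unfolding jacobian_ideal_def by blast
  then have "r * x = F * (r * w) + (\<Sum>j\<in>UNIV. partial_deriv j F * (r * v j))"
    by (simp add: distrib_left sum_distrib_left mult_ac)
  also have "\<dots> \<in> jacobian_ideal F" by (rule jacobian_idealI)
  finally show "r * x \<in> jacobian_ideal F" .
qed

text \<open>Smoothness leaves at most the origin as a common zero of the ideal, and every variable
  vanishes there; the Nullstellensatz gives a power of each variable, and the largest of the four
  exponents serves all.\<close>

lemma smooth_imp_mvar_power_in_jacobian_ideal:
  assumes smooth: "smooth_hypersurface F"
  obtains s where "\<And>i. mvar i ^ s \<in> jacobian_ideal F"
proof -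
  note J = is_ideal_jacobian_ideal[of F]
  have FJ: "F \<in> jacobian_ideal F" using jacobian_idealI[of F 1 "\<lambda>_. 0"] by simp
  have dJ: "partial_deriv i F \<in> jacobian_ideal F" for i
    using jacobian_idealI[of F 0 "\<lambda>j. if j = i then 1 else 0"] by (simp add: if_distrib cong: if_cong)
  have "\<exists>s. mvar i ^ s \<in> jacobian_ideal F" for i
  proof (rule nullstellensatz4[OF J])
    fix x assume "\<And>f. f \<in> jacobian_ideal F \<Longrightarrow> eval_ac x f = 0"
    then have "eval_ac x F = 0" "\<forall>i. eval_ac x (partial_deriv i F) = 0" using FJ dJ by auto
    then have "x = (\<lambda>_. 0)" using smooth unfolding smooth_hypersurface_def by blast
    then show "eval_ac x (mvar i) = 0"
      by (simp add: eval_ac_eq_eval4 eval4_mvar[OF is_ring_hom_to_ac])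
  qed blast
  then obtain s where s: "\<And>i. mvar i ^ s i \<in> jacobian_ideal F" by metis
  have "mvar i ^ Max (range s) \<in> jacobian_ideal F" for i
  proof -
    have "s i \<le> Max (range s)" by simp
    then have "mvar i ^ Max (range s) = mvar i ^ (Max (range s) - s i) * mvar i ^ s i"
      by (simp flip: power_add)
    then show ?thesis using is_ideal_mult[OF J s] by metis
  qed
  then show thesis by (rule that)
qed

section \<open>Taylor expansion and Frobenius\<close>

text \<open>This is \<open>f\<close> with \<open>X_i\<close> replaced by \<open>X_i + t\<close>,
  where \<open>t\<close> is the outer variable. Its coefficients are the Hasse derivatives, which
  avoid the division by factorials that fails in characteristic \<open>p\<close>.\<close>

definition taylor :: "4 \<Rightarrow> 'k::field poly4 \<Rightarrow> 'k poly4 poly" where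
  "taylor i = eval4 (\<lambda>c. [:mconst c:]) (\<lambda>j. if j = i then [:mvar j, 1:] else [:mvar j:])"

lemma is_ring_hom_const_poly_mconst: "is_ring_hom (\<lambda>c::'k::field. [:mconst c:])"
  by (rule is_ring_homI) (simp_all add: single_add mult_single one_pCons mult_ac)

lemma is_ring_hom_taylor: "is_ring_hom (taylor i)"
  unfolding taylor_def by (rule is_ring_hom_eval4[OF is_ring_hom_const_poly_mconst])

lemma taylor_single:
  "taylor i (Poly_Mapping.single u c) =
     smult (mconst c * (\<Prod>j\<in>UNIV - {i}. mvar j ^ Poly_Mapping.lookup u j))
       ([:mvar i, 1:] ^ Poly_Mapping.lookup u i)"
proof -
  have "taylor i (Poly_Mapping.single u c) =
    [:mconst c:] * (\<Prod>j\<in>UNIV. (if j = i then [:mvar j, 1:] else [:mvar j:]) ^ Poly_Mapping.lookup u j)"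
    unfolding taylor_def by (rule eval4_single[OF is_ring_hom_const_poly_mconst])
  also have "(\<Prod>j\<in>UNIV. (if j = i then [:mvar j, 1:] else [:mvar j:]) ^ Poly_Mapping.lookup u j) =
      [:mvar i, 1:] ^ Poly_Mapping.lookup u i *
      (\<Prod>j\<in>UNIV - {i}. (if j = i then [:mvar j, 1:] else [:mvar j:]) ^ Poly_Mapping.lookup u j)"
    by (subst prod.remove[of _ i]) simp_all
  also have "(\<Prod>j\<in>UNIV - {i}. (if j = i then [:mvar j, 1:] else [:mvar j:]) ^ Poly_Mapping.lookup u j) =
      (\<Prod>j\<in>UNIV - {i}. [:mvar j ^ Poly_Mapping.lookup u j:] :: 'a poly4 poly)"
    by (intro prod.cong) (auto simp: poly_const_pow)
  also have "\<dots> = [:\<Prod>j\<in>UNIV - {i}. mvar j ^ Poly_Mapping.lookup u j:]"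
    by (rule hom_prod[symmetric]) (auto intro!: is_ring_homI simp: one_pCons)
  finally show ?thesis by (simp add: mult_ac)
qed

lemma coeff_0_taylor: "coeff (taylor i f) 0 = f"
proof (induction f rule: poly_mapping_single_induct)
  case (single u c)
  have "coeff (taylor i (Poly_Mapping.single u c)) 0 = mconst c * (\<Prod>j\<in>UNIV. mvar j ^ Poly_Mapping.lookup u j)"
    by (simp add: taylor_single coeff_0_power prod.remove[of UNIV i] mult_ac)
  then show ?case using single_eq_mconst_mvar[of u c] by simp
qed (simp_all add: hom_0[OF is_ring_hom_taylor] hom_add[OF is_ring_hom_taylor])

lemma coeff_1_linear_power: "coeff ([:a, 1:] ^ n) 1 = of_nat n * a ^ (n - 1)"
proof (induction n)
  case (Suc n)
  then show ?case by (cases n) (simp_all add: coeff_0_power algebra_simps)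
qed simp

lemma partial_deriv_single:
  "partial_deriv i (Poly_Mapping.single u c) =
     Poly_Mapping.single (u - Poly_Mapping.single i 1) (of_nat (Poly_Mapping.lookup u i) * c)"
  by (cases "c = 0") (simp_all add: partial_deriv_def)

lemma partial_deriv_add: "partial_deriv i (f + g) = partial_deriv i f + partial_deriv i g"
proof -
  let ?t = "\<lambda>f u. Poly_Mapping.single (u - Poly_Mapping.single i 1)
    (of_nat (Poly_Mapping.lookup u i) * Poly_Mapping.lookup f u)"
  let ?A = "Poly_Mapping.keys f \<union> Poly_Mapping.keys g"
  have "partial_deriv i f' = (\<Sum>u\<in>?A. ?t f' u)" if "f' \<in> {f, g, f + g}" for f'
    unfolding partial_deriv_def
    by (rule sum.mono_neutral_left) (use that keys_add[of f g] in \<open>auto simp: in_keys_iff\<close>)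
  then show ?thesis
    by (simp add: lookup_add distrib_left single_add sum.distrib)
qed

lemma coeff_1_taylor: "coeff (taylor i f) 1 = partial_deriv i f"
proof (induction f rule: poly_mapping_single_induct)
  case (single u c)
  let ?n = "Poly_Mapping.lookup u i" and ?v = "u - Poly_Mapping.single i 1"
  let ?R = "\<Prod>j\<in>UNIV - {i}. mvar j ^ Poly_Mapping.lookup u j :: 'a poly4"
  have v: "(\<Prod>j\<in>UNIV - {i}. mvar j ^ Poly_Mapping.lookup ?v j) = ?R"
    by (intro prod.cong) (auto simp: lookup_minus lookup_single)
  have "partial_deriv i (Poly_Mapping.single u c) = mconst (of_nat ?n * c) * (mvar i ^ Poly_Mapping.lookup ?v i * ?R)"
    unfolding partial_deriv_single
    by (subst single_eq_mconst_mvar) (simp add: prod.remove[of UNIV i] v del: One_nat_def)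
  also have "mconst (of_nat ?n * c) = of_nat ?n * mconst c"
    by (simp add: hom_mult[OF is_ring_hom_mconst])
  finally show ?case
    by (simp add: taylor_single coeff_1_linear_power lookup_minus mult_ac del: One_nat_def)
qed (simp_all add: hom_0[OF is_ring_hom_taylor] hom_add[OF is_ring_hom_taylor] partial_deriv_add
      , simp add: partial_deriv_def)

lemma CHAR_poly4 [simp]: "CHAR('k::field poly4) = CHAR('k)"
proof (rule CHAR_eqI)
  have of_nat: "of_nat n = mconst (of_nat n :: 'k)" for n by simp
  have inj: "mconst c = 0 \<longleftrightarrow> c = 0" for c :: 'k by (metis lookup_single_eq lookup_zero single_zero)
  show "of_nat CHAR('k) = (0 :: 'k poly4)" unfolding of_nat by (simp del: single_of_nat)
  show "CHAR('k) dvd n" if "of_nat n = (0 :: 'k poly4)" for n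
    using that unfolding of_nat inj by (simp add: of_nat_eq_0_iff_char_dvd)
qed

locale frobenius_exponent =
  fixes q :: nat and K :: "'k::field itself"
  assumes prime_char: "Factorial_Ring.prime CHAR('k)" and q_eq: "\<exists>n. q = CHAR('k) ^ n"
begin

lemma q_pos: "q > 0"
  using prime_char q_eq prime_gt_0_nat by auto

lemma frob_add: "(x + y) ^ q = x ^ q + y ^ q" if "CHAR('a) = CHAR('k)" for x y :: "'a::comm_ring_1"
  using q_eq prime_char freshmans_dream'[where 'a='a] that by metis

lemma frob_sum: "sum f A ^ q = (\<Sum>i\<in>A. f i ^ q)" if "CHAR('a) = CHAR('k)" for f :: "_ \<Rightarrow> 'a::comm_ring_1"
  using q_eq prime_char freshmans_dream_sum'[where 'a='a] that by metis

definition hasse :: "4 \<Rightarrow> 'k poly4 \<Rightarrow> 'k poly4" where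
  "hasse i f = coeff (taylor i f) (q - 1)"

lemma hasse_add: "hasse i (f + g) = hasse i f + hasse i g"
  by (simp add: hasse_def hom_add[OF is_ring_hom_taylor])

text \<open>By the freshman's dream the expansion of \<open>g ^ q\<close> is \<open>g ^ q\<close>
  plus a multiple of \<open>t ^ q\<close>, and the latter does not reach the coefficient of
  \<open>t ^ (q - 1)\<close>.\<close>

lemma hasse_frob_mult: "hasse i (g ^ q * f) = g ^ q * hasse i f"
proof -
  obtain k where k: "taylor i g = pCons g k"
    using coeff_0_taylor[of i g] by (cases "taylor i g") auto
  have "taylor i g = [:g:] + monom 1 1 * k" by (simp add: k monom_altdef)
  then have "taylor i g ^ q = [:g:] ^ q + (monom 1 1 * k) ^ q"
    by (simp only:) (rule frob_add, simp)
  also have "\<dots> = [:g ^ q:] + monom 1 q * k ^ q"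
    by (simp add: poly_const_pow power_mult_distrib monom_power)
  finally have "taylor i (g ^ q * f) = [:g ^ q:] * taylor i f + monom 1 q * (k ^ q * taylor i f)"
    by (simp add: hom_mult[OF is_ring_hom_taylor] hom_power[OF is_ring_hom_taylor] algebra_simps)
  then show ?thesis
    using q_pos by (simp add: hasse_def coeff_monom_mult)
qed

text \<open>Modulo \<open>F\<close> the expansion of \<open>F\<close> is \<open>t * k\<close> with
  constant term of \<open>k\<close> equal to the partial derivative. Its power of exponent
  \<open>q - 1\<close> therefore starts at \<open>t ^ (q - 1)\<close>, so that only constant terms
  of the other factors contribute there.\<close>

lemma hasse_power_mult:
  obtains r where "hasse i (F ^ (q - 1) * f) = partial_deriv i F ^ (q - 1) * f + F * r"
proof -
  let ?m = "q - 1"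
  obtain a k where "taylor i F = pCons a k" by (cases "taylor i F") auto
  then have k: "taylor i F = pCons F k" "coeff k 0 = partial_deriv i F"
    using coeff_0_taylor[of i F] coeff_1_taylor[of i F] by auto
  have power_mod: "\<exists>r. (x + y) ^ n = y ^ n + x * r" for x y :: "'k poly4 poly" and n
  proof (induction n)
    case (Suc n)
    then obtain r where "(x + y) ^ n = y ^ n + x * r" by blast
    then have "(x + y) ^ Suc n = y ^ Suc n + x * (y ^ n + (x + y) * r)"
      by (simp add: algebra_simps)
    then show ?case by blast
  qed (auto intro!: exI[of _ 0])
  obtain r where "([:F:] + monom 1 1 * k) ^ ?m = (monom 1 1 * k) ^ ?m + [:F:] * r"
    using power_mod by blast
  moreover have "taylor i F = [:F:] + monom 1 1 * k" by (simp add: k monom_altdef)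
  ultimately have "taylor i F ^ ?m = monom 1 ?m * k ^ ?m + [:F:] * r"
    by (simp add: power_mult_distrib monom_power)
  then have "taylor i (F ^ ?m * f) = monom 1 ?m * (k ^ ?m * taylor i f) + smult F (r * taylor i f)"
    by (simp add: hom_mult[OF is_ring_hom_taylor] hom_power[OF is_ring_hom_taylor] algebra_simps)
  then have "hasse i (F ^ ?m * f) = coeff k 0 ^ ?m * f + F * coeff (r * taylor i f) ?m"
    by (simp add: hasse_def coeff_monom_mult coeff_mult_0 coeff_0_power coeff_0_taylor)
  then show thesis unfolding k(2) by (rule that)
qed

end

section \<open>Flatness of Frobenius\<close>

abbreviation exp_div :: "(4 \<Rightarrow>\<^sub>0 nat) \<Rightarrow> nat \<Rightarrow> (4 \<Rightarrow>\<^sub>0 nat)" where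
  "exp_div u q \<equiv> Poly_Mapping.map (\<lambda>n. n div q) u"

abbreviation exp_mod :: "(4 \<Rightarrow>\<^sub>0 nat) \<Rightarrow> nat \<Rightarrow> (4 \<Rightarrow>\<^sub>0 nat)" where
  "exp_mod u q \<equiv> Poly_Mapping.map (\<lambda>n. n mod q) u"

lemma lookup_exp_div: "Poly_Mapping.lookup (exp_div u q) i = Poly_Mapping.lookup u i div q"
  by (simp add: map.rep_eq when_def)

lemma lookup_exp_mod: "Poly_Mapping.lookup (exp_mod u q) i = Poly_Mapping.lookup u i mod q"
  by (simp add: map.rep_eq when_def)

lemma lookup_exp_times: "Poly_Mapping.lookup (Poly_Mapping.map ((*) (q::nat)) u) i = q * Poly_Mapping.lookup u i"
  by (simp add: map.rep_eq when_def)

lemma single_power: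
  "Poly_Mapping.single u c ^ n =
     (Poly_Mapping.single (Poly_Mapping.map ((*) n) u) (c ^ n) :: 'k::comm_ring_1 poly4)"
proof (induction n)
  case 0
  have "Poly_Mapping.map ((*) 0) u = 0" by (rule poly_mapping_eqI) (simp add: map.rep_eq)
  then show ?case by (metis power_0 single_one)
next
  case (Suc n)
  have "u + Poly_Mapping.map ((*) n) u = Poly_Mapping.map ((*) (Suc n)) u"
    by (rule poly_mapping_eqI) (simp add: lookup_add lookup_exp_times)
  with Suc show ?case by (simp only: power_Suc mult_single)
qed

context frobenius_exponent
begin

text \<open>Coordinates of \<open>K\<close> as a vector space over its subfield of \<open>q\<close>-th powers, the scalar action
  being twisted by the Frobenius so that the scalars are again \<open>K\<close>.\<close>

lemma field_frob_coordinates: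
  obtains c :: "'k \<Rightarrow> 'k \<Rightarrow> 'k" where
    "\<And>b x y. c b (x + y) = c b x + c b y" "\<And>b r x. c b (r ^ q * x) = r * c b x"
    "\<And>x. finite {b. c b x \<noteq> 0}" "\<And>x. (\<Sum>b | c b x \<noteq> 0. c b x ^ q * b) = x"
proof -
  interpret vs: vector_space "\<lambda>r x :: 'k. r ^ q * x"
    by unfold_locales (simp_all add: algebra_simps frob_add power_mult_distrib)
  define B where "B = vs.extend_basis {}"
  have "vs.independent {}" by (rule vs.independent_empty)
  then have B: "vs.independent B" "vs.span B = UNIV"
    unfolding B_def by (rule vs.independent_extend_basis vs.span_extend_basis; assumption)+
  define c where "c b x = vs.representation B x b" for b x
  show thesis
  proof (rule that[of c])
    show "c b (x + y) = c b x + c b y" for b x y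
      unfolding c_def using B by (simp add: vs.representation_add)
    show "c b (r ^ q * x) = r * c b x" for b r x
      unfolding c_def using B by (simp add: vs.representation_scale)
    show "finite {b. c b x \<noteq> 0}" for x
      unfolding c_def by (rule vs.finite_representation)
    show "(\<Sum>b | c b x \<noteq> 0. c b x ^ q * b) = x" for x
      unfolding c_def using B by (simp add: vs.sum_nonzero_representation_eq)
  qed
qed

text \<open>A basis over the q-th powers consists of the products of a basis element of
  \<open>K\<close> over its q-th powers and a monomial with all exponents below \<open>q\<close>.
  The maps \<open>\<pi> l\<close> return q-th roots of the coordinates, so a factor
  \<open>g ^ q\<close> comes out as \<open>g\<close>.\<close>

lemma frob_coordinates:
  obtains \<pi> :: "'k \<times> (4 \<Rightarrow>\<^sub>0 nat) \<Rightarrow> 'k poly4 \<Rightarrow> 'k poly4" and e where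
    "\<And>l f g. \<pi> l (f + g) = \<pi> l f + \<pi> l g" "\<And>l f g. \<pi> l (g ^ q * f) = g * \<pi> l f"
    "\<And>f. \<exists>A. finite A \<and> f = (\<Sum>l\<in>A. \<pi> l f ^ q * e l)"
proof -
  obtain c :: "'k \<Rightarrow> 'k \<Rightarrow> 'k" where
    c: "\<And>b x y. c b (x + y) = c b x + c b y" "\<And>b r x. c b (r ^ q * x) = r * c b x"
    "\<And>x. finite {b. c b x \<noteq> 0}" "\<And>x. (\<Sum>b | c b x \<noteq> 0. c b x ^ q * b) = x"
    using field_frob_coordinates by blast
  have c0 [simp]: "c b 0 = 0" for b using c(2)[of b 0 0] by simp
  let ?t = "\<lambda>l f u. if exp_mod u q = snd l
    then Poly_Mapping.single (exp_div u q) (c (fst l) (Poly_Mapping.lookup f u)) else 0"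
  define \<pi> where "\<pi> l f = (\<Sum>u\<in>Poly_Mapping.keys f. ?t l f u)" for l and f :: "'k poly4"
  define e :: "'k \<times> (4 \<Rightarrow>\<^sub>0 nat) \<Rightarrow> 'k poly4" where "e l = Poly_Mapping.single (snd l) (fst l)" for l
  have superset: "\<pi> l f = (\<Sum>u\<in>A. ?t l f u)" if "finite A" "Poly_Mapping.keys f \<subseteq> A" for l f A
    unfolding \<pi>_def by (rule sum.mono_neutral_left) (use that in \<open>auto simp: in_keys_iff\<close>)
  have \<pi>0 [simp]: "\<pi> l 0 = 0" for l by (simp add: \<pi>_def)
  have \<pi>_single: "\<pi> l (Poly_Mapping.single u a) =
      (if exp_mod u q = snd l then Poly_Mapping.single (exp_div u q) (c (fst l) a) else 0)" for l u a
    by (subst superset[of "{u}"]) auto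
  have \<pi>_add: "\<pi> l (f + g) = \<pi> l f + \<pi> l g" for l f g
  proof -
    let ?A = "Poly_Mapping.keys f \<union> Poly_Mapping.keys g"
    have "\<pi> l h = (\<Sum>u\<in>?A. ?t l h u)" if "h \<in> {f, g, f + g}" for h
      using that keys_add[of f g] by (intro superset) auto
    then show ?thesis by (simp add: lookup_add c(1) single_add if_distrib sum.distrib[symmetric] cong: if_cong)
  qed
  have mult: "\<pi> l (g ^ q * f) = g * \<pi> l f" for l g f
  proof (induction g rule: poly_mapping_single_induct)
    case zero
    then show ?case using q_pos by (simp add: power_0_left)
  next
    case (single w d)
    show ?case
    proof (induction f rule: poly_mapping_single_induct)
      case (single u a)
      let ?w = "Poly_Mapping.map ((*) q) w"
      have "exp_mod (?w + u) q = exp_mod u q" "exp_div (?w + u) q = w + exp_div u q"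
        using q_pos
        by (auto intro!: poly_mapping_eqI simp: lookup_exp_mod lookup_exp_div lookup_exp_times lookup_add)
      then show ?case by (simp add: single_power mult_single \<pi>_single c(2))
    qed (simp_all add: distrib_left \<pi>_add)
  next
    case (add g h)
    then show ?case by (simp add: frob_add distrib_right \<pi>_add)
  qed
  \<comment> \<open>Stated for all finite supersets, so that the expansions of two summands can be
    added over a common index set.\<close>
  have "\<exists>A. finite A \<and> (\<forall>A'. finite A' \<longrightarrow> A \<subseteq> A' \<longrightarrow> f = (\<Sum>l\<in>A'. \<pi> l f ^ q * e l))" for f
  proof (induction f rule: poly_mapping_single_induct)
    case zero
    show ?case using q_pos by (intro exI[of _ "{}"]) (simp add: power_0_left)
  next
    case (single u a)
    let ?A = "{b. c b a \<noteq> 0} \<times> {exp_mod u q}"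
    have u: "Poly_Mapping.map ((*) q) (exp_div u q) + exp_mod u q = u"
      by (rule poly_mapping_eqI) (simp add: lookup_add lookup_exp_mod lookup_exp_div lookup_exp_times)
    have A: "finite ?A" using c(3) by simp
    have "Poly_Mapping.single u a = (\<Sum>l\<in>A'. \<pi> l (Poly_Mapping.single u a) ^ q * e l)"
      if A': "finite A'" "?A \<subseteq> A'" for A'
    proof -
      have "(\<Sum>l\<in>A'. \<pi> l (Poly_Mapping.single u a) ^ q * e l) = (\<Sum>l\<in>?A. \<pi> l (Poly_Mapping.single u a) ^ q * e l)"
        using A' q_pos by (intro sum.mono_neutral_right) (auto simp: \<pi>_single power_0_left)
      also have "\<dots> = (\<Sum>l\<in>?A. Poly_Mapping.single u (c (fst l) a ^ q * fst l))"
        by (intro sum.cong) (auto simp: \<pi>_single e_def single_power mult_single u)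
      also have "\<dots> = (\<Sum>b | c b a \<noteq> 0. Poly_Mapping.single u (c b a ^ q * b))"
        by (rule sum.reindex_bij_witness[of _ "\<lambda>b. (b, exp_mod u q)" fst]) auto
      also have "\<dots> = Poly_Mapping.single u (\<Sum>b | c b a \<noteq> 0. c b a ^ q * b)"
        by (rule poly_mapping_eqI) (simp add: lookup_sum lookup_single when_def)
      finally show ?thesis by (simp add: c(4))
    qed
    with A show ?case by blast
  next
    case (add f g)
    from add(1) obtain A1 where A1: "finite A1"
      "\<forall>A'. finite A' \<longrightarrow> A1 \<subseteq> A' \<longrightarrow> f = (\<Sum>l\<in>A'. \<pi> l f ^ q * e l)" by (elim exE conjE)
    from add(2) obtain A2 where A2: "finite A2"
      "\<forall>A'. finite A' \<longrightarrow> A2 \<subseteq> A' \<longrightarrow> g = (\<Sum>l\<in>A'. \<pi> l g ^ q * e l)" by (elim exE conjE)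
    have "f + g = (\<Sum>l\<in>A'. \<pi> l (f + g) ^ q * e l)" if A': "finite A'" "A1 \<union> A2 \<subseteq> A'" for A'
    proof -
      have "f + g = (\<Sum>l\<in>A'. \<pi> l f ^ q * e l) + (\<Sum>l\<in>A'. \<pi> l g ^ q * e l)"
        using A' A1(2)[rule_format, of A'] A2(2)[rule_format, of A']
        by (intro arg_cong2[of _ _ _ _ "(+)"]) blast+
      also have "\<dots> = (\<Sum>l\<in>A'. \<pi> l (f + g) ^ q * e l)"
        by (simp add: \<pi>_add frob_add distrib_right sum.distrib)
      finally show ?thesis .
    qed
    then have "\<forall>A'. finite A' \<longrightarrow> A1 \<union> A2 \<subseteq> A' \<longrightarrow> f + g = (\<Sum>l\<in>A'. \<pi> l (f + g) ^ q * e l)"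
      by (intro allI impI)
    moreover have "finite (A1 \<union> A2)" using A1(1) A2(1) by simp
    ultimately show ?case by (intro exI conjI)
  qed
  then have repr: "\<exists>A. finite A \<and> f = (\<Sum>l\<in>A. \<pi> l f ^ q * e l)" for f
    by (metis (no_types) subset_refl)
  show thesis by (rule that[of \<pi> e]) (rule \<pi>_add mult repr)+
qed

end

section \<open>Annihilation by powers of the variables, before and after Frobenius\<close>

definition ideal3 :: "'a::comm_ring_1 \<Rightarrow> 'a \<Rightarrow> 'a \<Rightarrow> 'a set" where
  "ideal3 f g h = {f * s + g * t + h * u | s t u. True}"

lemma ideal3I: "f * s + g * t + h * u \<in> ideal3 f g h"
  unfolding ideal3_def by blast

lemma ideal3E:
  assumes "x \<in> ideal3 f g h"
  obtains s t u where "x = f * s + g * t + h * u"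
  using assms unfolding ideal3_def by blast

lemma is_ideal_ideal3: "is_ideal (ideal3 f g h)"
proof (rule is_idealI)
  show "0 \<in> ideal3 f g h" using ideal3I[of f 0 g 0 h 0] by simp
next
  fix x y assume "x \<in> ideal3 f g h" "y \<in> ideal3 f g h"
  then obtain s t u s' t' u' where "x = f * s + g * t + h * u" "y = f * s' + g * t' + h * u'"
    by (meson ideal3E)
  then have "x + y = f * (s + s') + g * (t + t') + h * (u + u')" by (simp add: algebra_simps)
  then show "x + y \<in> ideal3 f g h" using ideal3I by metis
next
  fix r x assume "x \<in> ideal3 f g h"
  then obtain s t u where "x = f * s + g * t + h * u" by (rule ideal3E)
  then have "r * x = f * (r * s) + g * (r * t) + h * (r * u)" by (simp add: algebra_simps)
  then show "r * x \<in> ideal3 f g h" using ideal3I by metis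
qed

lemma gens_in_ideal3: "f \<in> ideal3 f g h" "g \<in> ideal3 f g h" "h \<in> ideal3 f g h"
  using ideal3I[of f 1 g 0 h 0] ideal3I[of f 0 g 1 h 0] ideal3I[of f 0 g 0 h 1] by simp_all

lemma ideal3_subset:
  assumes "is_ideal I" "f \<in> I" "g \<in> I" "h \<in> I"
  shows "ideal3 f g h \<subseteq> I"
proof
  fix x assume "x \<in> ideal3 f g h"
  then obtain s t u where "x = f * s + g * t + h * u" by (rule ideal3E)
  then show "x \<in> I" using assms by (auto intro: is_ideal_add is_ideal_mult')
qed

context frobenius_exponent
begin

text \<open>The coordinate maps send the Frobenius power of the ideal into the ideal and turn the
  multiplier \<open>(mvar i ^ k) ^ q\<close> into \<open>mvar i ^ k\<close>. So the hypothesis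
  \<open>sat\<close> applies to each coordinate of \<open>y\<close>, and raising to the q-th power
  and recombining gives the claim.\<close>

lemma saturation_ideal3_frob:
  fixes F A B :: "'k poly4"
  assumes sat: "\<And>y. (\<forall>i. mvar i ^ k * y \<in> ideal3 F A B) \<Longrightarrow> \<forall>i. mvar i ^ n * y \<in> ideal3 F A B"
    and y: "\<And>i. (mvar i ^ k) ^ q * y \<in> ideal3 (F ^ q) (A ^ q) (B ^ q)"
  shows "(mvar i ^ n) ^ q * y \<in> ideal3 (F ^ q) (A ^ q) (B ^ q)"
proof -
  let ?J = "ideal3 F A B" and ?G = "ideal3 (F ^ q) (A ^ q) (B ^ q)"
  obtain \<pi> :: "'k \<times> (4 \<Rightarrow>\<^sub>0 nat) \<Rightarrow> 'k poly4 \<Rightarrow> 'k poly4" and e where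
    \<pi>: "\<And>l f g. \<pi> l (f + g) = \<pi> l f + \<pi> l g" "\<And>l f g. \<pi> l (g ^ q * f) = g * \<pi> l f"
    and repr: "\<And>f. \<exists>A. finite A \<and> f = (\<Sum>l\<in>A. \<pi> l f ^ q * e l)"
    using frob_coordinates by blast
  have "\<pi> l z \<in> ?J" if "z \<in> ?G" for l z
  proof -
    from that obtain s t u where "z = F ^ q * s + A ^ q * t + B ^ q * u" by (rule ideal3E)
    then show ?thesis by (simp add: \<pi> ideal3I)
  qed
  then have "\<forall>i. mvar i ^ k * \<pi> l y \<in> ?J" for l using y \<pi>(2) by metis
  then have J: "mvar i ^ n * \<pi> l y \<in> ?J" for l using sat by blast
  have frob: "z ^ q \<in> ?G" if "z \<in> ?J" for z
  proof -
    from that obtain s t u where "z = F * s + A * t + B * u" by (rule ideal3E)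
    then have "z ^ q = F ^ q * s ^ q + A ^ q * t ^ q + B ^ q * u ^ q"
      by (simp add: frob_add power_mult_distrib)
    then show ?thesis using ideal3I by metis
  qed
  obtain L where "y = (\<Sum>l\<in>L. \<pi> l y ^ q * e l)" using repr by blast
  then have "(mvar i ^ n) ^ q * y = (mvar i ^ n) ^ q * (\<Sum>l\<in>L. \<pi> l y ^ q * e l)"
    by (rule arg_cong)
  also have "\<dots> = (\<Sum>l\<in>L. e l * (mvar i ^ n * \<pi> l y) ^ q)"
    by (simp add: sum_distrib_left power_mult_distrib mult_ac)
  also have "\<dots> \<in> ?G"
    by (intro is_ideal_sum is_ideal_mult is_ideal_ideal3 frob J)
  finally show ?thesis .
qed

text \<open>The operator \<open>hasse j (F ^ (q - 1) * _)\<close> carries \<open>ideal3 F (A ^ q) (B ^ q)\<close> into the Frobenius power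
  \<open>ideal3 (F ^ q) (A ^ q) (B ^ q)\<close>, where flatness applies, and modulo \<open>F\<close> it is multiplication by
  a power of a partial derivative.\<close>

lemma saturation_bound_frob:
  fixes F A B x :: "'k poly4"
  assumes jac: "\<And>i. mvar i ^ s \<in> jacobian_ideal F"
    and sat: "\<And>y k. (\<forall>i. mvar i ^ k * y \<in> ideal3 F A B) \<Longrightarrow> \<forall>i. mvar i ^ n * y \<in> ideal3 F A B"
    and x: "\<And>i. mvar i ^ k * x \<in> ideal3 F (A ^ q) (B ^ q)"
  shows "mvar i ^ ((s + n) * q) * x \<in> ideal3 F (A ^ q) (B ^ q)"
proof -
  let ?G = "ideal3 F (A ^ q) (B ^ q)" and ?Gq = "ideal3 (F ^ q) (A ^ q) (B ^ q)"
  note G = is_ideal_ideal3[of F "A ^ q" "B ^ q"]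
  have Fq: "F ^ q = F ^ (q - 1) * F" using q_pos by (metis power_minus_mult)
  have "F ^ q \<in> ?G" unfolding Fq by (intro is_ideal_mult G gens_in_ideal3)
  then have Gq_sub: "?Gq \<subseteq> ?G" by (intro ideal3_subset G gens_in_ideal3)
  have "(mvar i ^ n) ^ q * partial_deriv j F ^ q * x \<in> ?G" for j
  proof -
    define y where "y = hasse j (F ^ (q - 1) * x)"
    have "(mvar i' ^ k) ^ q * y \<in> ?Gq" for i'
    proof -
      \<comment> \<open>The exponent \<open>k\<close> is enlarged to \<open>k * q\<close>, because
        only q-th powers commute with \<open>hasse\<close>.\<close>
      have "(mvar i' ^ k) ^ q * x = mvar i' ^ (k * (q - 1)) * (mvar i' ^ k * x)"
        using q_pos by (cases q)
          (simp_all add: add.commute flip: power_mult power_add mult.assoc)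
      also have "\<dots> \<in> ?G" by (intro is_ideal_mult G x)
      finally obtain t u v where *: "(mvar i' ^ k) ^ q * x = F * t + A ^ q * u + B ^ q * v"
        by (rule ideal3E)
      have "(mvar i' ^ k) ^ q * (F ^ (q - 1) * x) = F ^ (q - 1) * ((mvar i' ^ k) ^ q * x)"
        by (simp add: mult_ac)
      also have "\<dots> = F ^ q * t + A ^ q * (F ^ (q - 1) * u) + B ^ q * (F ^ (q - 1) * v)"
        unfolding * Fq by (simp add: algebra_simps)
      finally have "(mvar i' ^ k) ^ q * y =
          F ^ q * hasse j t + A ^ q * hasse j (F ^ (q - 1) * u) + B ^ q * hasse j (F ^ (q - 1) * v)"
        unfolding y_def by (metis hasse_frob_mult hasse_add)
      then show ?thesis using ideal3I by metis
    qed
    then have y: "(mvar i ^ n) ^ q * y \<in> ?G"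
      using saturation_ideal3_frob[of k F A B n y i] sat Gq_sub by blast
    obtain r where r: "y = partial_deriv j F ^ (q - 1) * x + F * r"
      unfolding y_def by (rule hasse_power_mult)
    \<comment> \<open>One more factor raises the exponent to \<open>q\<close>, as required for
      combining the derivatives through Frobenius.\<close>
    have "partial_deriv j F ^ q = partial_deriv j F * partial_deriv j F ^ (q - 1)"
      using q_pos by (metis power_minus_mult mult.commute)
    then have "(mvar i ^ n) ^ q * partial_deriv j F ^ q * x =
        partial_deriv j F * ((mvar i ^ n) ^ q * y) - (partial_deriv j F * (mvar i ^ n) ^ q * r) * F"
      unfolding r by (simp add: algebra_simps)
    also have "\<dots> \<in> ?G" by (intro is_ideal_diff is_ideal_mult G y gens_in_ideal3)
    finally show ?thesis .
  qed
  note deriv = this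
  obtain w v where "mvar i ^ s = F * w + (\<Sum>j\<in>UNIV. partial_deriv j F * v j)"
    using jac unfolding jacobian_ideal_def by blast
  \<comment> \<open>Frobenius is applied to a relation that puts \<open>mvar i ^ s\<close> into the
    Jacobian ideal; this yields the q-th powers of the derivatives, with an exponent linear in
    \<open>q\<close>.\<close>
  then have s_q: "(mvar i ^ s) ^ q = F ^ q * w ^ q + (\<Sum>j\<in>UNIV. partial_deriv j F ^ q * v j ^ q)"
    by (simp add: frob_add frob_sum power_mult_distrib)
  have "mvar i ^ ((s + n) * q) * x = (mvar i ^ s) ^ q * ((mvar i ^ n) ^ q * x)"
    by (simp add: distrib_right power_add power_mult mult.assoc)
  also have "\<dots> = (w ^ q * (mvar i ^ n) ^ q * x) * F ^ q +
      (\<Sum>j\<in>UNIV. v j ^ q * ((mvar i ^ n) ^ q * partial_deriv j F ^ q * x))"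
    unfolding s_q by (simp add: distrib_left distrib_right sum_distrib_left sum_distrib_right mult_ac)
  also have "\<dots> \<in> ?G"
    by (intro is_ideal_add is_ideal_mult is_ideal_sum G deriv \<open>F ^ q \<in> ?G\<close>)
  finally show ?thesis .
qed

end

text \<open>The elements killed modulo \<open>J\<close> by the k-th powers of all variables form an
  ideal increasing with \<open>k\<close>; the index at which this chain becomes stationary works for
  every \<open>k\<close>.\<close>

lemma acc_saturation_bound:
  assumes J: "is_ideal J"
  obtains n where "\<And>(y :: 'k::field poly4) k. (\<forall>i. mvar i ^ k * y \<in> J) \<Longrightarrow> \<forall>i. mvar i ^ n * y \<in> J"
proof -
  define I where "I k = {y. \<forall>i. mvar i ^ k * y \<in> J}" for k
  have ideal: "is_ideal (I k)" for k
    by (rule is_idealI)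
      (auto simp: I_def is_ideal_0[OF J] distrib_left is_ideal_add[OF J]
        mult.left_commute[of "mvar _ ^ k"] is_ideal_mult[OF J])
  have mono: "I m \<subseteq> I n" if "m \<le> n" for m n
  proof
    fix y assume "y \<in> I m"
    then have y: "mvar i ^ m * y \<in> J" for i by (simp add: I_def)
    have "mvar i ^ n * y \<in> J" for i
    proof -
      have "mvar i ^ n * y = mvar i ^ (n - m) * (mvar i ^ m * y)"
        using that by (simp flip: power_add mult.assoc)
      also have "\<dots> \<in> J" by (rule is_ideal_mult[OF J y])
      finally show ?thesis .
    qed
    then show "y \<in> I n" by (simp add: I_def)
  qed
  have "\<exists>N. \<forall>n\<ge>N. I n = I N"
    using acc_ideals_poly4[unfolded acc_ideals_def, rule_format, of I] ideal mono
    by (auto simp: mono_def)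
  then obtain N where N: "\<And>n. n \<ge> N \<Longrightarrow> I n = I N" by blast
  show thesis
  proof (rule that)
    fix y k assume "\<forall>i. mvar i ^ k * y \<in> J"
    then have "y \<in> I k" by (simp add: I_def)
    also have "\<dots> \<subseteq> I (max k N)" by (rule mono) simp
    also have "\<dots> = I N" by (rule N) simp
    finally show "\<forall>i. mvar i ^ N * y \<in> J" by (simp add: I_def)
  qed
qed

text \<open>The exponent \<open>s\<close> depends on \<open>F\<close> alone and \<open>m\<close> on
  the ideal of \<open>F\<close>, \<open>A\<close> and \<open>B\<close>, so \<open>c = s + m\<close>
  is fixed before \<open>n\<close> is chosen.\<close>

theorem smooth_saturation_bound:
  fixes F A B :: "'k::field poly4"
  assumes smooth: "smooth_hypersurface F" and prime: "Factorial_Ring.prime CHAR('k)"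
  obtains c where "\<And>n x k. (\<And>i. mvar i ^ k * x \<in> ideal3 F (A ^ (CHAR('k) ^ n)) (B ^ (CHAR('k) ^ n))) \<Longrightarrow>
    (\<And>i. mvar i ^ (c * CHAR('k) ^ n) * x \<in> ideal3 F (A ^ (CHAR('k) ^ n)) (B ^ (CHAR('k) ^ n)))"
proof -
  obtain s where s: "\<And>i. mvar i ^ s \<in> jacobian_ideal F"
    using smooth_imp_mvar_power_in_jacobian_ideal[OF smooth] by blast
  obtain m where m: "\<And>y k. (\<forall>i. mvar i ^ k * y \<in> ideal3 F A B) \<Longrightarrow> \<forall>i. mvar i ^ m * y \<in> ideal3 F A B"
    using acc_saturation_bound[OF is_ideal_ideal3] by blast
  show thesis
  proof (rule that)
    fix n x k i
    assume x: "\<And>i. mvar i ^ k * x \<in> ideal3 F (A ^ (CHAR('k) ^ n)) (B ^ (CHAR('k) ^ n))"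
    interpret frobenius_exponent "CHAR('k) ^ n" "TYPE('k)"
      by unfold_locales (use prime in blast)+
    show "mvar i ^ ((s + m) * CHAR('k) ^ n) * x \<in> ideal3 F (A ^ (CHAR('k) ^ n)) (B ^ (CHAR('k) ^ n))"
      by (rule saturation_bound_frob[OF s m x])
  qed
qed

section \<open>Translation to the coordinate ring\<close>

lemma residue_class_hom: "residue_class F \<in> ring_hom poly4_ring (coord_ring F)"
  and Idl_poly4_ideal: "ideal (Idl\<^bsub>poly4_ring\<^esub> {F}) poly4_ring"
proof -
  interpret S: cring "poly4_ring :: 'a poly4 ring" by (rule cring_from_type_algebra)
  show *: "ideal (Idl\<^bsub>poly4_ring\<^esub> {F}) poly4_ring" for F :: "'a poly4"
    by (rule S.genideal_ideal) (simp add: ring_of_type_algebra_def)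
  show "residue_class F \<in> ring_hom poly4_ring (coord_ring F)" for F :: "'a poly4"
    using ideal.rcos_ring_hom[OF *] by (simp add: residue_class_def[abs_def] coord_ring_def)
qed

lemma residue_class_simps:
  shows residue_class_add: "residue_class F (f + g) = residue_class F f \<oplus>\<^bsub>coord_ring F\<^esub> residue_class F g"
    and residue_class_mult: "residue_class F (f * g) = residue_class F f \<otimes>\<^bsub>coord_ring F\<^esub> residue_class F g"
    and residue_class_1: "residue_class F 1 = \<one>\<^bsub>coord_ring F\<^esub>"
  using ring_hom_add[OF residue_class_hom[of F], of f g] ring_hom_mult[OF residue_class_hom[of F], of f g]
    ring_hom_one[OF residue_class_hom[of F]]
  by (simp_all add: ring_of_type_algebra_def)

lemma carrier_coord_ring: "carrier (coord_ring F) = range (residue_class F)"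
  by (auto simp: coord_ring_def FactRing_def A_RCOSETS_def' residue_class_def ring_of_type_algebra_def)

lemma residue_class_closed [simp]: "residue_class F f \<in> carrier (coord_ring F)"
  by (simp add: carrier_coord_ring)

lemma residue_class_power: "residue_class F (f ^ n) = residue_class F f [^]\<^bsub>coord_ring F\<^esub> n"
proof -
  interpret R: cring "coord_ring F" by (rule cring_coord_ring)
  show ?thesis
    by (induction n) (simp_all add: residue_class_1 residue_class_mult R.m_comm)
qed

lemma residue_class_eq_iff:
  "residue_class F f = residue_class F g \<longleftrightarrow> (\<exists>s. f - g = F * s)"
proof -
  interpret S: cring "poly4_ring :: 'a poly4 ring" by (rule cring_from_type_algebra)
  have "f \<ominus>\<^bsub>poly4_ring\<^esub> g = f - g"
  proof -
    have "(f - g) \<oplus>\<^bsub>poly4_ring\<^esub> g = f" by (simp add: ring_of_type_algebra_def)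
    moreover have "a \<in> carrier poly4_ring" for a :: "'a poly4" by (simp add: ring_of_type_algebra_def)
    ultimately show ?thesis by (metis S.add.inv_solve_right' a_minus_def)
  qed
  moreover have "Idl\<^bsub>poly4_ring\<^esub> {F} = {s * F | s. True}"
    using S.cgenideal_eq_genideal[of F] by (auto simp: cgenideal_def ring_of_type_algebra_def)
  ultimately show ?thesis
    using S.quotient_eq_iff_same_a_r_cos[OF Idl_poly4_ideal[of F], of f g]
    by (auto simp: residue_class_def ring_of_type_algebra_def mult.commute)
qed

lemma residue_class_0: "residue_class F 0 = \<zero>\<^bsub>coord_ring F\<^esub>"
proof -
  interpret R: cring "coord_ring F" by (rule cring_coord_ring)
  have "residue_class F 0 \<oplus>\<^bsub>coord_ring F\<^esub> residue_class F 0 = residue_class F 0"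
    by (simp flip: residue_class_add)
  then show ?thesis by (metis R.add.r_cancel_one' residue_class_closed)
qed

lemma residue_class_uminus: "residue_class F (- f) = \<ominus>\<^bsub>coord_ring F\<^esub> residue_class F f"
proof -
  interpret R: cring "coord_ring F" by (rule cring_coord_ring)
  have "residue_class F (- f) \<oplus>\<^bsub>coord_ring F\<^esub> residue_class F f = \<zero>\<^bsub>coord_ring F\<^esub>"
    by (simp add: residue_class_0 flip: residue_class_add)
  then show ?thesis by (simp add: R.minus_equality)
qed

lemma ideal_residue_class_image:
  assumes I: "is_ideal I"
  shows "ideal (residue_class F ` I) (coord_ring F)"
proof -
  interpret R: cring "coord_ring F" by (rule cring_coord_ring)
  show ?thesis
  proof (rule idealI)
    show "subgroup (residue_class F ` I) (add_monoid (coord_ring F))"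
    proof (rule R.add.subgroupI)
      show "residue_class F ` I \<noteq> {}" using is_ideal_0[OF I] by blast
    qed (auto simp: is_ideal_uminus[OF I] is_ideal_add[OF I] simp flip: residue_class_uminus residue_class_add)
  next
    fix x y assume "x \<in> residue_class F ` I" "y \<in> carrier (coord_ring F)"
    then obtain f g where "x = residue_class F f" "f \<in> I" "y = residue_class F g"
      by (auto simp: carrier_coord_ring)
    then show "y \<otimes>\<^bsub>coord_ring F\<^esub> x \<in> residue_class F ` I" "x \<otimes>\<^bsub>coord_ring F\<^esub> y \<in> residue_class F ` I"
      using is_ideal_mult[OF I, of f g] is_ideal_mult'[OF I, of f g]
      by (auto simp flip: residue_class_mult)
  qed (rule R.ring_axioms)
qed

lemma is_ideal_residue_class_vimage:
  assumes "ideal J (coord_ring F)"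
  shows "is_ideal (residue_class F -` J)"
proof -
  interpret J: ideal J "coord_ring F" by fact
  show ?thesis
    using J.I_l_closed
    by (intro is_idealI) (auto simp: residue_class_0 residue_class_add residue_class_mult)
qed

text \<open>An ideal containing \<open>F\<close> is the full preimage of its image, so membership
  can be tested in either ring.\<close>

lemma residue_class_in_image_iff:
  assumes I: "is_ideal I" and "F \<in> I"
  shows "residue_class F f \<in> residue_class F ` I \<longleftrightarrow> f \<in> I"
proof
  assume "residue_class F f \<in> residue_class F ` I"
  then obtain g s where "g \<in> I" "f - g = F * s" using residue_class_eq_iff by blast
  then have "f = g + F * s" by (simp add: algebra_simps)
  then show "f \<in> I" using \<open>g \<in> I\<close> \<open>F \<in> I\<close> by (simp add: is_ideal_add[OF I] is_ideal_mult'[OF I])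
qed blast

text \<open>The Frobenius power is generated by the q-th powers of all elements of the ideal;
  additivity of Frobenius reduces these to the two generators.\<close>

lemma (in frobenius_exponent) frobenius_power_residue_class:
  fixes F A B :: "'k poly4"
  shows "frobenius_power (coord_ring F) (Idl\<^bsub>coord_ring F\<^esub> {residue_class F A, residue_class F B}) q =
     residue_class F ` ideal3 F (A ^ q) (B ^ q)"
  (is "?L = residue_class F ` ?G")
proof -
  interpret R: cring "coord_ring F" by (rule cring_coord_ring)
  let ?I = "Idl\<^bsub>coord_ring F\<^esub> {residue_class F A, residue_class F B}"
  have gens: "{residue_class F A, residue_class F B} \<subseteq> carrier (coord_ring F)" by simp
  have I: "ideal ?I (coord_ring F)" by (rule R.genideal_ideal[OF gens])
  have I_sub: "?I \<subseteq> residue_class F ` ideal3 F A B"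
    by (intro R.genideal_minimal ideal_residue_class_image is_ideal_ideal3) (auto simp: gens_in_ideal3)
  show ?thesis
  proof
    have "x [^]\<^bsub>coord_ring F\<^esub> q \<in> residue_class F ` ?G" if x: "x \<in> ?I" for x
    proof -
      obtain z where z: "z \<in> ideal3 F A B" "x = residue_class F z" using x I_sub by blast
      then obtain s t u where "x = residue_class F (F * s + A * t + B * u)" by (metis ideal3E)
      then have "x [^]\<^bsub>coord_ring F\<^esub> q = residue_class F ((F * s + A * t + B * u) ^ q)"
        by (simp add: residue_class_power)
      \<comment> \<open>\<open>F ^ q\<close> is absorbed as a multiple of \<open>F\<close>: in the
        lifted ideal \<open>F\<close> stands to the first power, since its class is zero.\<close>
      also have "(F * s + A * t + B * u) ^ q = F * (F ^ (q - 1) * s ^ q) + A ^ q * t ^ q + B ^ q * u ^ q"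
        using power_minus_mult[OF q_pos, of F] by (simp add: frob_add power_mult_distrib mult_ac)
      finally show ?thesis by (simp add: ideal3I)
    qed
    then show "?L \<subseteq> residue_class F ` ?G"
      unfolding frobenius_power_def
      by (intro R.genideal_minimal ideal_residue_class_image is_ideal_ideal3) blast
  next
    have I_carr: "x \<in> ?I \<Longrightarrow> x \<in> carrier (coord_ring F)" for x
      by (rule ideal.Icarr[OF I])
    have sub: "{x [^]\<^bsub>coord_ring F\<^esub> q | x. x \<in> ?I} \<subseteq> carrier (coord_ring F)"
      using I_carr by auto
    then have L: "ideal ?L (coord_ring F)"
      unfolding frobenius_power_def by (rule R.genideal_ideal)
    have "x [^]\<^bsub>coord_ring F\<^esub> q \<in> ?L" if "x \<in> ?I" for x
      unfolding frobenius_power_def using R.genideal_self[OF sub] that by blast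
    moreover have "residue_class F A \<in> ?I" "residue_class F B \<in> ?I"
      using R.genideal_self[OF gens] by auto
    ultimately have "residue_class F (A ^ q) \<in> ?L" "residue_class F (B ^ q) \<in> ?L"
      by (simp_all add: residue_class_power)
    moreover have "residue_class F F = residue_class F 0"
      unfolding residue_class_eq_iff by (auto intro: exI[of _ 1])
    then have "residue_class F F \<in> ?L"
      using is_ideal_0[OF is_ideal_residue_class_vimage[OF L]] by simp
    ultimately have "?G \<subseteq> residue_class F -` ?L"
      by (intro ideal3_subset is_ideal_residue_class_vimage L) auto
    then show "residue_class F ` ?G \<subseteq> ?L" by blast
  qed
qed

section \<open>Powers of the irrelevant ideal and degrees of monomials\<close>

definition min_degree :: "nat \<Rightarrow> 'k::field poly4 set" where
  "min_degree k = {f. \<forall>u\<in>Poly_Mapping.keys f. k \<le> (\<Sum>i\<in>UNIV. Poly_Mapping.lookup u i)}"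

lemma min_degree_mult:
  fixes f g :: "'k::field poly4"
  assumes "f \<in> min_degree k" "g \<in> min_degree l"
  shows "f * g \<in> min_degree (k + l)"
  unfolding min_degree_def
proof (intro CollectI ballI)
  fix u assume "u \<in> Poly_Mapping.keys (f * g)"
  then obtain v w where "u = v + w" "v \<in> Poly_Mapping.keys f" "w \<in> Poly_Mapping.keys g"
    using keys_mult by blast
  then show "k + l \<le> (\<Sum>i\<in>UNIV. Poly_Mapping.lookup u i)"
    using assms by (auto simp: min_degree_def lookup_add sum.distrib intro!: add_mono)
qed

lemma is_ideal_min_degree: "is_ideal (min_degree k :: 'k::field poly4 set)"
proof (rule is_idealI)
  show "0 \<in> min_degree k" by (simp add: min_degree_def)
  show "f + g \<in> min_degree k" if "f \<in> min_degree k" "g \<in> min_degree k" for f g :: "'k poly4"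
    using that keys_add[of f g] by (auto simp: min_degree_def)
  show "r * f \<in> min_degree k" if "f \<in> min_degree k" for r f :: "'k poly4"
    using min_degree_mult[of r 0 f k] that by (simp add: min_degree_def)
qed

text \<open>Pigeonhole over the four exponents of a monomial.\<close>

lemma min_degree_mult_in_ideal:
  fixes f x :: "'k::field poly4"
  assumes I: "is_ideal I" and f: "f \<in> min_degree (4 * K)" and x: "\<And>i. mvar i ^ K * x \<in> I"
  shows "f * x \<in> I"
proof -
  have "Poly_Mapping.single u c * x \<in> I" if u: "4 * K \<le> (\<Sum>i\<in>UNIV. Poly_Mapping.lookup u i)" for u c
  proof (cases "K = 0")
    case True
    then show ?thesis using x is_ideal_mult[OF I] by simp
  next
    case False
    have "\<exists>i. K \<le> Poly_Mapping.lookup u i"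
    proof (rule ccontr)
      assume "\<not> ?thesis"
      then have "(\<Sum>i\<in>UNIV. Poly_Mapping.lookup u i) < (\<Sum>i\<in>(UNIV :: 4 set). K)"
        by (intro sum_strict_mono) (auto simp: not_le)
      then show False using u by simp
    qed
    then obtain i where i: "K \<le> Poly_Mapping.lookup u i" by blast
    have "u - Poly_Mapping.single i K + Poly_Mapping.single i K = u"
      by (rule poly_mapping_eqI) (use i in \<open>auto simp: lookup_add lookup_minus lookup_single when_def\<close>)
    then have "Poly_Mapping.single u c = Poly_Mapping.single (u - Poly_Mapping.single i K) c * mvar i ^ K"
      by (simp add: mvar_power mult_single)
    then have "Poly_Mapping.single u c * x = Poly_Mapping.single (u - Poly_Mapping.single i K) c * (mvar i ^ K * x)"
      by (simp only: mult.assoc)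
    also have "\<dots> \<in> I" by (rule is_ideal_mult[OF I x])
    finally show ?thesis .
  qed
  then have "(\<Sum>u\<in>Poly_Mapping.keys f. Poly_Mapping.single u (Poly_Mapping.lookup f u) * x) \<in> I"
    using f by (intro is_ideal_sum[OF I]) (auto simp: min_degree_def)
  also have "(\<Sum>u\<in>Poly_Mapping.keys f. Poly_Mapping.single u (Poly_Mapping.lookup f u) * x) =
      (\<Sum>u\<in>Poly_Mapping.keys f. Poly_Mapping.single u (Poly_Mapping.lookup f u)) * x"
    by (rule sum_distrib_right[symmetric])
  also have "\<dots> = f * x"
    by (rule arg_cong[where f = "\<lambda>z. z * x"]) (rule poly_mapping_sum_singles[symmetric])
  finally show ?thesis .
qed

lemma irrelevant_ideal_subset: "irrelevant_ideal F \<subseteq> residue_class F ` min_degree 1"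
proof -
  interpret R: cring "coord_ring F" by (rule cring_coord_ring)
  have "homogeneous_elements F d \<subseteq> residue_class F ` min_degree 1" if "d \<ge> 1" for d
    using that by (force simp: homogeneous_elements_def homogeneous_def min_degree_def)
  then show ?thesis
    unfolding irrelevant_ideal_def
    by (intro R.genideal_minimal ideal_residue_class_image is_ideal_min_degree) auto
qed

lemma residue_class_mvar_in_irrelevant_ideal: "residue_class F (mvar i) \<in> irrelevant_ideal F"
proof -
  interpret R: cring "coord_ring F" by (rule cring_coord_ring)
  have sub: "(\<Union>d\<in>{1..}. homogeneous_elements F d) \<subseteq> carrier (coord_ring F)"
    by (auto simp: homogeneous_elements_def)
  have "homogeneous 1 (mvar i)"
    by (simp add: homogeneous_def mvar_def lookup_single when_def)
  then have "residue_class F (mvar i) \<in> homogeneous_elements F 1"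
    by (auto simp: homogeneous_elements_def)
  then show ?thesis
    unfolding irrelevant_ideal_def using R.genideal_self[OF sub] by fastforce
qed

lemma ideal_power_0: "ideal_power R I (0::nat) = carrier R"
  by (simp add: nat_pow_def ideals_set_def)

lemma ideal_power_Suc: "ideal_power R I (Suc k) = ideal_prod R (ideal_power R I k) I"
  by (simp add: nat_pow_def ideals_set_def)

text \<open>Lower half of the comparison with monomials: whatever is killed by a power of the
  irrelevant ideal is killed by the same powers of the variables.\<close>

lemma residue_class_mvar_power_in_ideal_power:
  "residue_class F (mvar i ^ k) \<in> ideal_power (coord_ring F) (irrelevant_ideal F) k"
proof (induction k)
  case 0
  show ?case unfolding ideal_power_0 by simp
next
  case (Suc k)
  have "residue_class F (mvar i ^ Suc k) = residue_class F (mvar i ^ k) \<otimes>\<^bsub>coord_ring F\<^esub> residue_class F (mvar i)"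
    unfolding power_Suc2 by (rule residue_class_mult)
  then show ?case
    unfolding ideal_power_Suc
    by (simp only:) (rule ideal_prod.prod[OF Suc residue_class_mvar_in_irrelevant_ideal])
qed

text \<open>Upper half: degrees add under products, so elements of the k-th power lift to
  polynomials all of whose monomials have degree at least \<open>k\<close>.\<close>

lemma ideal_power_irrelevant_subset:
  "ideal_power (coord_ring F) (irrelevant_ideal F) k \<subseteq> residue_class F ` min_degree k"
proof (induction k)
  case 0
  have "min_degree 0 = (UNIV :: 'a poly4 set)" by (simp add: min_degree_def)
  then show ?case unfolding ideal_power_0 carrier_coord_ring by simp
next
  case (Suc k)
  show ?case
    unfolding ideal_power_Suc
  proof
    fix r assume "r \<in> ideal_prod (coord_ring F) (ideal_power (coord_ring F) (irrelevant_ideal F) k) (irrelevant_ideal F)"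
    then show "r \<in> residue_class F ` min_degree (Suc k)"
    proof induction
      case (prod x y)
      then obtain f g where "x = residue_class F f" "f \<in> min_degree k" "y = residue_class F g" "g \<in> min_degree 1"
        using Suc.IH irrelevant_ideal_subset by blast
      then show ?case
        using min_degree_mult[of f k g 1] by (auto simp flip: residue_class_mult)
    next
      case (sum x y)
      then show ?case
        by (auto simp: is_ideal_add[OF is_ideal_min_degree] simp flip: residue_class_add)
    qed
  qed
qed

lemma smult_quot_module_eq_0_iff:
  assumes "cring R" "ideal J R" "r \<in> carrier R" "y \<in> carrier R"
  shows "r \<odot>\<^bsub>quot_module R J\<^esub> (J +>\<^bsub>R\<^esub> y) = \<zero>\<^bsub>quot_module R J\<^esub> \<longleftrightarrow> r \<otimes>\<^bsub>R\<^esub> y \<in> J"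
proof -
  interpret R: cring R by fact
  interpret J: ideal J R by fact
  have "r \<odot>\<^bsub>quot_module R J\<^esub> (J +>\<^bsub>R\<^esub> y) = J +>\<^bsub>R\<^esub> (r \<otimes>\<^bsub>R\<^esub> y)"
    using assms by (simp add: quot_module_def FactRing_def J.rcoset_mult_add)
  moreover have "\<zero>\<^bsub>quot_module R J\<^esub> = J" by (simp add: quot_module_def FactRing_def)
  moreover have "J +>\<^bsub>R\<^esub> (r \<otimes>\<^bsub>R\<^esub> y) = J \<longleftrightarrow> r \<otimes>\<^bsub>R\<^esub> y \<in> J"
    using J.rcos_const_imp_mem[OF R.m_closed[OF assms(3,4)]] R.a_rcos_zero[OF assms(2)] by blast
  ultimately show ?thesis by simp
qed

lemma quot_module_carrierE:
  assumes "x \<in> carrier (quot_module R J)"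
  obtains y where "y \<in> carrier R" "x = J +>\<^bsub>R\<^esub> y"
  using assms by (auto simp: quot_module_def FactRing_def A_RCOSETS_def')

theorem corollary1p3:
  fixes F :: "'k::field poly4" and p :: nat and a b :: "'k poly4 set" and d e :: nat
  assumes "Factorial_Ring.prime p" and "CHAR('k) = p"
    and "homogeneous 4 F" and "smooth_hypersurface F"
    and "a \<in> homogeneous_elements F d" and "b \<in> homogeneous_elements F e"
    and "\<exists>x::real. e_gHK (coord_ring F) (irrelevant_ideal F) p (Idl\<^bsub>coord_ring F\<^esub> {a, b}) = ereal x
           \<and> x \<notin> \<rat>"
  shows "LC_condition (coord_ring F) (irrelevant_ideal F) p (Idl\<^bsub>coord_ring F\<^esub> {a, b})"
proof -
  let ?R = "coord_ring F" and ?m = "irrelevant_ideal F"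
  obtain A B where AB: "a = residue_class F A" "b = residue_class F B"
    using assms(5,6) by (auto simp: homogeneous_elements_def)
  have prime: "Factorial_Ring.prime CHAR('k)" using assms by simp
  obtain c where c: "\<And>n x k i. (\<And>i. mvar i ^ k * x \<in> ideal3 F (A ^ (p ^ n)) (B ^ (p ^ n))) \<Longrightarrow>
      mvar i ^ (c * p ^ n) * x \<in> ideal3 F (A ^ (p ^ n)) (B ^ (p ^ n))"
    using smooth_saturation_bound[OF assms(4) prime, of A B] unfolding assms(2) by blast
  have "r \<odot>\<^bsub>M\<^esub> x = \<zero>\<^bsub>M\<^esub>"
    if M: "M = quot_module ?R (frobenius_power ?R (Idl\<^bsub>?R\<^esub> {a, b}) (p ^ n))"
      and r: "r \<in> ideal_power ?R ?m (4 * c * p ^ n)" and x: "x \<in> local_cohomology0 ?R ?m M" for n M r x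
  proof -
    let ?G = "ideal3 F (A ^ (p ^ n)) (B ^ (p ^ n))"
    note G = is_ideal_ideal3[of F "A ^ (p ^ n)" "B ^ (p ^ n)"]
    interpret frobenius_exponent "p ^ n" "TYPE('k)"
      by unfold_locales (use assms(1,2) in auto)
    let ?J = "residue_class F ` ?G"
    have M_eq: "M = quot_module ?R ?J"
      unfolding M AB by (simp only: frobenius_power_residue_class)
    have J: "ideal ?J ?R" by (rule ideal_residue_class_image[OF G])
    have zero_iff: "residue_class F f \<odot>\<^bsub>M\<^esub> (?J +>\<^bsub>?R\<^esub> residue_class F g) = \<zero>\<^bsub>M\<^esub> \<longleftrightarrow> f * g \<in> ?G" for f g
      unfolding M_eq smult_quot_module_eq_0_iff[OF cring_coord_ring J residue_class_closed residue_class_closed]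
      by (simp add: residue_class_in_image_iff[OF G gens_in_ideal3(1)] flip: residue_class_mult)
    obtain k where xM: "x \<in> carrier M" and k: "\<And>s. s \<in> ideal_power ?R ?m k \<Longrightarrow> s \<odot>\<^bsub>M\<^esub> x = \<zero>\<^bsub>M\<^esub>"
      using x unfolding local_cohomology0_def by blast
    obtain y where y: "x = ?J +>\<^bsub>?R\<^esub> residue_class F y"
      using xM unfolding M_eq carrier_coord_ring[symmetric]
      by (rule quot_module_carrierE) (auto simp: carrier_coord_ring)
    \<comment> \<open>Of the annihilation by the k-th power of the irrelevant ideal only the powers
      of single variables are retained.\<close>
    have "mvar i ^ k * y \<in> ?G" for i
      using k[OF residue_class_mvar_power_in_ideal_power] unfolding y zero_iff .
    then have bound: "mvar i ^ (c * p ^ n) * y \<in> ?G" for i by (rule c)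
    \<comment> \<open>Total degree \<open>4 * (c * p ^ n)\<close> forces one of the four exponents
      of a monomial up to \<open>c * p ^ n\<close>, where \<open>bound\<close> applies; this is the
      source of the constant \<open>4 * c\<close>.\<close>
    have "r \<in> residue_class F ` min_degree (4 * (c * p ^ n))"
      using subsetD[OF ideal_power_irrelevant_subset r] by (simp only: mult.assoc)
    then obtain f where f: "r = residue_class F f" "f \<in> min_degree (4 * (c * p ^ n))" by blast
    show ?thesis
      unfolding f(1) y zero_iff by (rule min_degree_mult_in_ideal[OF G f(2) bound])
  qed
  then show ?thesis
    unfolding LC_condition_def Let_def by blast
qed

end
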